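(* Let $p\ge0$, $q\ge0$, $m\ge0$ be integers and let $f,g,h$ be entire functions represented by vector valued Dirichlet series such that $f$ has relative index-pair $(m,q)$ and $g$ has relative index-pair $(m,p)$ with respect to $h$. Suppose $\lambda_h^{(m,p)}(g)=\rho_h^{(m,p)}(g)$. Then $$\left[\frac{\overline{\Delta}_h^{(m,q)}(f)}{\Delta_h^{(m,p)}(g)}\right]^{\frac{1}{\rho_h^{(m,p)}(g)}}\le\overline{\Delta}_g^{(p,q)}(f)\le\min\left\{\left[\frac{\overline{\Delta}_h^{(m,q)}(f)}{\overline{\Delta}_h^{(m,p)}(g)}\right]^{\frac{1}{\rho_h^{(m,p)}(g)}},\left[\frac{\Delta_h^{(m,q)}(f)}{\Delta_h^{(m,p)}(g)}\right]^{\frac{1}{\rho_h^{(m,p)}(g)}}\right\}$$ $$\le\max\left\{\left[\frac{\overline{\Delta}_h^{(m,q)}(f)}{\overline{\Delta}_h^{(m,p)}(g)}\right]^{\frac{1}{\rho_h^{(m,p)}(g)}},\left[\frac{\Delta_h^{(m,q)}(f)}{\Delta_h^{(m,p)}(g)}\right]^{\frac{1}{\rho_h^{(m,p)}(g)}}\right\}\le\Delta_g^{(p,q)}(f)\le\left[\frac{\Delta_h^{(m,q)}(f)}{\overline{\Delta}_h^{(m,p)}(g)}\right]^{\frac{1}{\rho_h^{(m,p)}(g)}}$$ and $$\left[\frac{\tau_h^{(m,q)}(f)}{\overline{\tau}_h^{(m,p)}(g)}\right]^{\frac{1}{\lambda_h^{(m,p)}(g)}}\le\tau_g^{(p,q)}(f)\le\min\left\{\left[\frac{\tau_h^{(m,q)}(f)}{\tau_h^{(m,p)}(g)}\right]^{\frac{1}{\lambda_h^{(m,p)}(g)}},\left[\frac{\overline{\tau}_h^{(m,q)}(f)}{\overline{\tau}_h^{(m,p)}(g)}\right]^{\frac{1}{\lambda_h^{(m,p)}(g)}}\right\}$$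 $$\le\max\left\{\left[\frac{\tau_h^{(m,q)}(f)}{\tau_h^{(m,p)}(g)}\right]^{\frac{1}{\lambda_h^{(m,p)}(g)}},\left[\frac{\overline{\tau}_h^{(m,q)}(f)}{\overline{\tau}_h^{(m,p)}(g)}\right]^{\frac{1}{\lambda_h^{(m,p)}(g)}}\right\}\le\overline{\tau}_g^{(p,q)}(f)\le\left[\frac{\overline{\tau}_h^{(m,q)}(f)}{\tau_h^{(m,p)}(g)}\right]^{\frac{1}{\lambda_h^{(m,p)}(g)}}.$$
   Context: VVDS: an entire function represented by a vector valued Dirichlet series is a function $f(s)=\sum_{n\ge1}a_ne^{s\lambda_n}$, $s=\sigma+it$, not identically zero, with $a_n$ in a complex Banach space $(E,\|\cdot\|)$, $0<\lambda_n<\lambda_{n+1}$, $\lambda_n\to+\infty$, $\limsup_{n}\frac{\log n}{\lambda_n}<+\infty$ and $\limsup_{n}\frac{\log\|a_n\|}{\lambda_n}=-\infty$ (so the series converges absolutely everywhere). Its maximum modulus is $M_f(\sigma)=\sup_{t\in\mathbb R}\|f(\sigma+it)\|$, and $M_f^{-1}$ is the inverse function of $M_f$. Iterated logarithms: $\log^{[0]}x=x$, $\log^{[-1]}x=\exp x$, $\log^{[k]}x=\log(\log^{[k-1]}x)$ for $k\ge1$. Index-pair: for $k\ge q+1\ge1$ let $\rho_f(k,q)=\limsup_{\sigma\to+\infty}\frac{\log^{[k]}M_f(\sigma)}{\log^{[q]}\sigma}$ (the same formula is used for shifted indices). $f$ has index-pair $(1,1)$ if $0<\rho_f(1,1)<\infty$;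 otherwise $f$ has index-pair $(k,q)\neq(1,1)$, $k\ge q+1\ge1$, if $\delta_{k-q,0}<\rho_f(k,q)<\infty$ and $\rho_f(k-1,q-1)$ is not a positive real number, where $\delta_{i,j}=1$ if $i=j$ and $0$ otherwise. Relative Ritt orders: if $f$ and $g$ have index-pairs $(k,q)$ and $(k,p)$ with $k\ge q+1\ge1$, $k\ge p+1\ge1$, then $$\rho_g^{(p,q)}(f)=\limsup_{\sigma\to+\infty}\frac{\log^{[p]}M_g^{-1}(M_f(\sigma))}{\log^{[q]}\sigma},\qquad \lambda_g^{(p,q)}(f)=\liminf_{\sigma\to+\infty}\frac{\log^{[p]}M_g^{-1}(M_f(\sigma))}{\log^{[q]}\sigma}$$ are the $(p,q)$-th relative Ritt order and lower order of $f$ with respect to $g$. In this situation $f$ has relative index-pair $(p,q)$ with respect to $g$ if $b<\rho_g^{(p,q)}(f)<\infty$ and $\rho_g^{(p-1,q-1)}(f)$ (same formula) is not a nonzero finite number, where $b=1$ if $p=q=k$ and $b=0$ otherwise. Relative types: if $0<\rho_g^{(p,q)}(f)<\infty$, the relative Ritt type $\Delta_g^{(p,q)}(f)$ and lower type $\overline{\Delta}_g^{(p,q)}(f)$ are respectively the $\limsup$ and the $\liminf$ as $\sigma\to+\infty$ of $$\frac{\log^{[p-1]}M_g^{-1}(M_f(\sigma))}{[\log^{[q-1]}\sigma]^{\rho_g^{(p,q)}(f)}}.$$ If $0<\lambda_g^{(p,q)}(f)<\infty$, the relative Ritt weak type $\tau_g^{(p,q)}(f)$ and the indicator $\overline{\tau}_g^{(p,q)}(f)$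 are respectively the $\liminf$ and the $\limsup$ as $\sigma\to+\infty$ of $$\frac{\log^{[p-1]}M_g^{-1}(M_f(\sigma))}{[\log^{[q-1]}\sigma]^{\lambda_g^{(p,q)}(f)}}.$$ For other pairs of functions and indices the definitions are the same with the letters changed. The claim presupposes that all quantities appearing in it are defined, i.e. the corresponding orders or lower orders are positive and finite. Convention: types lie in $[0,\infty]$; quotients are taken with $a/0=\infty$ for $a>0$ and $a/\infty=0$ for $a<\infty$, and relations are asserted when every quotient is meaningful (no $0/0$ or $\infty/\infty$). *)

theory Defs
  imports "HOL-Analysis.Analysis"
begin

section \<open>Complex Banach spaces\<close>

class complex_banach = banach +
  fixes scaleC :: "complex \<Rightarrow> 'a \<Rightarrow> 'a" (infixr "*\<^sub>C" 75)
  assumes scaleC_add_right: "c *\<^sub>C (x + y) = c *\<^sub>C x + c *\<^sub>C y"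
    and scaleC_add_left: "(c + d) *\<^sub>C x = c *\<^sub>C x + d *\<^sub>C x"
    and scaleC_scaleC: "c *\<^sub>C d *\<^sub>C x = (c * d) *\<^sub>C x"
    and scaleC_of_real: "complex_of_real r *\<^sub>C x = r *\<^sub>R x"
    and norm_scaleC: "norm (c *\<^sub>C x) = cmod c * norm x"

instantiation complex :: complex_banach
begin

definition scaleC_complex :: "complex \<Rightarrow> complex \<Rightarrow> complex"
  where "scaleC_complex c x = c * x"

instance
  by standard (auto simp: scaleC_complex_def algebra_simps norm_mult scaleR_conv_of_real)

end

section \<open>Vector valued Dirichlet series\<close>

text \<open>
  Logarithm of a nonnegative real with \<open>log 0 = -\<infinity>\<close>, needed because coefficients may vanish
  whereas \<^const>\<open>ln\<close> is \<open>0\<close> at \<open>0\<close>.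
\<close>

definition elog :: "real \<Rightarrow> ereal"
  where "elog x = (if x \<le> 0 then -\<infinity> else ereal (ln x))"

text \<open>
  The sequences are indexed by \<open>n \<ge> 1\<close>; the values \<open>a 0\<close> and \<open>l 0\<close> are irrelevant.
\<close>

definition vvds :: "(complex \<Rightarrow> 'a::complex_banach) \<Rightarrow> bool"
  where "vvds f \<longleftrightarrow> (\<exists>s. f s \<noteq> 0) \<and>
    (\<exists>(a :: nat \<Rightarrow> 'a) (l :: nat \<Rightarrow> real).
      (\<forall>n\<ge>1. 0 < l n \<and> l n < l (Suc n)) \<and>
      filterlim l at_top sequentially \<and>
      limsup (\<lambda>n. ereal (ln (real n) / l n)) < \<infinity> \<and>
      limsup (\<lambda>n. elog (norm (a n)) / ereal (l n)) = -\<infinity> \<and>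
      (\<forall>s. (\<lambda>n. exp (s * complex_of_real (l (Suc n))) *\<^sub>C a (Suc n)) sums f s))"

definition max_mod :: "(complex \<Rightarrow> 'a::complex_banach) \<Rightarrow> real \<Rightarrow> real"
  where "max_mod f \<sigma> = (SUP t. norm (f (Complex \<sigma> t)))"

text \<open>
  For \<open>f\<close> with \<^term>\<open>vvds f\<close> the map \<^term>\<open>max_mod f\<close> is a strictly increasing bijection from the
  reals onto the positive reals; only arguments in that range occur below.
\<close>

definition max_mod_inv :: "(complex \<Rightarrow> 'a::complex_banach) \<Rightarrow> real \<Rightarrow> real"
  where "max_mod_inv f = inv (max_mod f)"

section \<open>Orders and index-pairs\<close>

text \<open>
  Negative indices give iterated exponentials, so index \<open>-1\<close> is \<^const>\<open>exp\<close>. All uses are under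
  limits at infinity of quantities tending to infinity, where every logarithm involved is
  eventually taken at a positive argument.
\<close>

definition iter_log :: "int \<Rightarrow> real \<Rightarrow> real"
  where "iter_log k x = (if k \<ge> 0 then (ln ^^ nat k) x else (exp ^^ nat (- k)) x)"

definition pos_finite :: "ereal \<Rightarrow> bool"
  where "pos_finite x \<longleftrightarrow> 0 < x \<and> x < \<infinity>"

definition ritt_order :: "(complex \<Rightarrow> 'a::complex_banach) \<Rightarrow> int \<Rightarrow> int \<Rightarrow> ereal"
  where "ritt_order f k q =
    Limsup at_top (\<lambda>\<sigma>. ereal (iter_log k (max_mod f \<sigma>) / iter_log q \<sigma>))"

definition has_index_pair :: "(complex \<Rightarrow> 'a::complex_banach) \<Rightarrow> int \<Rightarrow> int \<Rightarrow> bool"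
  where "has_index_pair f k q \<longleftrightarrow>
    (if pos_finite (ritt_order f 1 1) then k = 1 \<and> q = 1
     else (k, q) \<noteq> (1, 1) \<and> k \<ge> q + 1 \<and> q + 1 \<ge> 1 \<and>
       (if k - q = 0 then 1 else 0) < ritt_order f k q \<and> ritt_order f k q < \<infinity> \<and>
       \<not> pos_finite (ritt_order f (k - 1) (q - 1)))"

text \<open>
  In the following definitions the argument order \<open>g p q f\<close> corresponds to the notation
  \<open>\<rho>\<close> with lower index \<open>g\<close>, upper index \<open>(p, q)\<close> and argument \<open>f\<close>.
\<close>

definition rel_order ::
  "(complex \<Rightarrow> 'b::complex_banach) \<Rightarrow> int \<Rightarrow> int \<Rightarrow> (complex \<Rightarrow> 'a::complex_banach) \<Rightarrow> ereal"
  where "rel_order g p q f =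
    Limsup at_top (\<lambda>\<sigma>. ereal (iter_log p (max_mod_inv g (max_mod f \<sigma>)) / iter_log q \<sigma>))"

definition rel_lower_order ::
  "(complex \<Rightarrow> 'b::complex_banach) \<Rightarrow> int \<Rightarrow> int \<Rightarrow> (complex \<Rightarrow> 'a::complex_banach) \<Rightarrow> ereal"
  where "rel_lower_order g p q f =
    Liminf at_top (\<lambda>\<sigma>. ereal (iter_log p (max_mod_inv g (max_mod f \<sigma>)) / iter_log q \<sigma>))"

definition has_rel_index_pair ::
  "(complex \<Rightarrow> 'b::complex_banach) \<Rightarrow> int \<Rightarrow> int \<Rightarrow> (complex \<Rightarrow> 'a::complex_banach) \<Rightarrow> bool"
  where "has_rel_index_pair g p q f \<longleftrightarrow>
    (\<exists>k. k \<ge> q + 1 \<and> q + 1 \<ge> 1 \<and> k \<ge> p + 1 \<and> p + 1 \<ge> 1 \<and>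
      has_index_pair f k q \<and> has_index_pair g k p \<and>
      (if p = q \<and> q = k then 1 else 0) < rel_order g p q f \<and> rel_order g p q f < \<infinity> \<and>
      \<not> (rel_order g (p - 1) (q - 1) f \<noteq> 0 \<and> \<bar>rel_order g (p - 1) (q - 1) f\<bar> \<noteq> \<infinity>))"

section \<open>Relative types\<close>

text \<open>
  The types are meaningful only if the exponent (the relative order, respectively the relative
  lower order) is positive and finite; theorems must assume this.
\<close>

definition type_ratio ::
  "(complex \<Rightarrow> 'b::complex_banach) \<Rightarrow> int \<Rightarrow> int \<Rightarrow> (complex \<Rightarrow> 'a::complex_banach) \<Rightarrow> ereal
    \<Rightarrow> real \<Rightarrow> ereal"
  where "type_ratio g p q f e \<sigma> =
    ereal (iter_log (p - 1) (max_mod_inv g (max_mod f \<sigma>))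
      / (iter_log (q - 1) \<sigma>) powr (real_of_ereal e))"

definition rel_type ::
  "(complex \<Rightarrow> 'b::complex_banach) \<Rightarrow> int \<Rightarrow> int \<Rightarrow> (complex \<Rightarrow> 'a::complex_banach) \<Rightarrow> ereal"
  where "rel_type g p q f = Limsup at_top (type_ratio g p q f (rel_order g p q f))"

definition rel_lower_type ::
  "(complex \<Rightarrow> 'b::complex_banach) \<Rightarrow> int \<Rightarrow> int \<Rightarrow> (complex \<Rightarrow> 'a::complex_banach) \<Rightarrow> ereal"
  where "rel_lower_type g p q f = Liminf at_top (type_ratio g p q f (rel_order g p q f))"

definition rel_weak_type ::
  "(complex \<Rightarrow> 'b::complex_banach) \<Rightarrow> int \<Rightarrow> int \<Rightarrow> (complex \<Rightarrow> 'a::complex_banach) \<Rightarrow> ereal"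
  where "rel_weak_type g p q f = Liminf at_top (type_ratio g p q f (rel_lower_order g p q f))"

definition rel_weak_indicator ::
  "(complex \<Rightarrow> 'b::complex_banach) \<Rightarrow> int \<Rightarrow> int \<Rightarrow> (complex \<Rightarrow> 'a::complex_banach) \<Rightarrow> ereal"
  where "rel_weak_indicator g p q f =
    Limsup at_top (type_ratio g p q f (rel_lower_order g p q f))"

section \<open>Extended arithmetic for types\<close>

text \<open>
  Division on \<^typ>\<open>ereal\<close> satisfies \<open>a / 0 = \<infinity>\<close> for \<open>a > 0\<close> and \<open>a / \<infinity> = 0\<close> for finite \<open>a\<close>, but
  gives \<open>0 / 0 = 0\<close> and \<open>\<infinity> / \<infinity> = 0\<close>; the latter two are excluded by the following predicate.
\<close>

definition quot_ok :: "ereal \<Rightarrow> ereal \<Rightarrow> bool"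
  where "quot_ok a b \<longleftrightarrow> \<not> (a = 0 \<and> b = 0) \<and> \<not> (a = \<infinity> \<and> b = \<infinity>)"

text \<open>\<open>x\<close> to the power \<open>1 / e\<close>, for \<open>x\<close> in \<open>[0, \<infinity>]\<close> and positive finite \<open>e\<close>.\<close>

definition eroot :: "ereal \<Rightarrow> ereal \<Rightarrow> ereal"
  where "eroot e x = (if x = \<infinity> then \<infinity> else ereal (real_of_ereal x powr (1 / real_of_ereal e)))"

end

theory Submission
  imports Defs "HOL-Complex_Analysis.Complex_Analysis"
begin

text \<open>With \<open>r = M\<^sub>g\<^sup>-\<^sup>1 (M\<^sub>f \<sigma>)\<close> one has \<open>M\<^sub>h\<^sup>-\<^sup>1 (M\<^sub>f \<sigma>) = M\<^sub>h\<^sup>-\<^sup>1 (M\<^sub>g r)\<close>. Since the order of \<open>g\<close> with respect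
  to \<open>h\<close> is a limit \<open>A\<close>, the order of \<open>f\<close> with respect to \<open>h\<close> is \<open>A\<close> times that with respect to \<open>g\<close>,
  so the type ratio of \<open>f\<close> with respect to \<open>h\<close> at \<open>\<sigma>\<close> is the product of that of \<open>g\<close> with respect to
  \<open>h\<close> at \<open>r\<close> and the \<open>A\<close>-th power of that of \<open>f\<close> with respect to \<open>g\<close> at \<open>\<sigma>\<close>. The claims are then
  the inequalities for limits of products. Passing from \<open>\<sigma>\<close> to \<open>r\<close> requires that \<open>M\<^sub>f\<close> is an
  increasing bijection onto the positive reals; strict monotonicity and growth come from a maximum
  principle in left half planes applied to \<open>e\<^sup>-\<^sup>s\<^sup>\<lambda> f(s)\<close>, where \<open>\<lambda>\<close> is the exponent of the first nonzero term.\<close>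

section \<open>Limits inferior and superior of products, reciprocals and powers\<close>

text \<open>Every real \<open>z\<close> with \<open>0 < z < a * b\<close> is a product of positive
  reals strictly below \<open>a\<close> and \<open>b\<close>, so lower estimates of products need
  checking only for such factors. If \<open>a\<close> or \<open>b\<close> is \<open>0\<close>, the
  product is \<open>0\<close> and nothing remains to be shown.\<close>

lemma ereal_mult_le_by_approx:
  fixes a b c :: ereal
  assumes "0 \<le> a" "0 \<le> b" "0 \<le> c"
    and approx: "\<And>x y. 0 < x \<Longrightarrow> 0 < y \<Longrightarrow> ereal x < a \<Longrightarrow> ereal y < b \<Longrightarrow> ereal (x * y) \<le> c"
  shows "a * b \<le> c"
proof (rule dense_le)
  fix z assume z: "z < a * b"
  show "z \<le> c"
  proof (cases "z \<le> 0")
    case True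
    then show ?thesis using \<open>0 \<le> c\<close> by (rule order_trans)
  next
    case False
    then obtain z' where z': "z = ereal z'" "0 < z'"
      using z by (cases z) auto
    have pos: "0 < a" "0 < b"
      using z False assms(1,2) by (auto simp: order.strict_iff_order zero_ereal_def[symmetric])
    have "\<exists>x y. 0 < x \<and> 0 < y \<and> ereal x < a \<and> ereal y < b \<and> x * y = z'"
    proof (cases a)
      case a: (real a')
      show ?thesis
      proof (cases b)
        case b: (real b')
        have ab: "0 < a'" "0 < b'" "z' < a' * b'" using a b pos z z' by auto
        \<comment> \<open>Shrinking both factors by the square root of the ratio
          \<open>z' / (a' * b') < 1\<close> hits \<open>z'\<close> exactly.\<close>
        define t where "t = sqrt (z' / (a' * b'))"
        have t: "0 < t" "t < 1" using ab z' by (auto simp: t_def)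
        have "t * t = z' / (a' * b')" using ab z' by (simp add: t_def)
        then have "(a' * t) * (b' * t) = z'" using ab by (simp add: field_simps)
        moreover have "a' * t < a'" "b' * t < b'" using ab t by auto
        ultimately show ?thesis using a b ab t
          by (intro exI[of _ "a' * t"] exI[of _ "b' * t"]) auto
      next
        case PInf
        then show ?thesis using a pos z'
          by (intro exI[of _ "a' / 2"] exI[of _ "2 * z' / a'"]) auto
      qed (use pos in auto)
    next
      case a: PInf
      show ?thesis
      proof (cases b)
        case (real b')
        then show ?thesis using a pos z'
          by (intro exI[of _ "2 * z' / b'"] exI[of _ "b' / 2"]) auto
      next
        case PInf
        then show ?thesis using a z' by (intro exI[of _ z'] exI[of _ 1]) auto
      qed (use pos in auto)
    qed (use pos in auto)
    then show ?thesis using approx z' by auto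
  qed
qed

text \<open>Dual to the previous reduction, with factors strictly above. The product of
  \<open>0\<close> and infinity must be excluded: it is \<open>0\<close> for \<open>ereal\<close>,
  which is no upper bound for an indeterminate limit. Otherwise an infinite factor makes
  \<open>a * b\<close> infinite.\<close>

lemma ereal_le_mult_by_approx:
  fixes a b c :: ereal
  assumes "0 \<le> a" "0 \<le> b" and indet: "\<not> (a = 0 \<and> b = \<infinity>)" "\<not> (a = \<infinity> \<and> b = 0)"
    and approx: "\<And>x y. 0 < x \<Longrightarrow> 0 < y \<Longrightarrow> a < ereal x \<Longrightarrow> b < ereal y \<Longrightarrow> c \<le> ereal (x * y)"
  shows "c \<le> a * b"
proof (rule dense_ge)
  fix z assume z: "a * b < z"
  obtain a' where a: "a = ereal a'" "0 \<le> a'" using assms(1,2) indet z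
    by (cases a; cases b) (auto split: if_splits)
  obtain b' where b: "b = ereal b'" "0 \<le> b'" using assms(1,2) indet z
    by (cases a; cases b) (auto split: if_splits)
  show "c \<le> z"
  proof (cases z)
    case (real z')
    then have lt: "a' * b' < z'" using z a b by auto
    \<comment> \<open>Since \<open>d \<le> 1\<close>, the excess of
      \<open>(a' + d) * (b' + d)\<close> over \<open>a' * b'\<close> is at most
      \<open>d * (a' + b' + 1)\<close>; the second entry of the minimum keeps this below the gap to
      \<open>z'\<close>.\<close>
    define d where "d = min 1 ((z' - a' * b') / (a' + b' + 1))"
    have d: "0 < d" "d \<le> 1" "d \<le> (z' - a' * b') / (a' + b' + 1)"
      using lt a b by (auto simp: d_def)
    have "(a' + d) * (b' + d) = a' * b' + d * (a' + b' + d)" by (simp add: algebra_simps)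
    also have "\<dots> \<le> a' * b' + d * (a' + b' + 1)" using d by (intro add_left_mono mult_left_mono) auto
    also have "\<dots> \<le> z'" using d(3) a b by (simp add: field_simps)
    finally have "(a' + d) * (b' + d) \<le> z'" .
    moreover have "c \<le> ereal ((a' + d) * (b' + d))" using a b d by (intro approx) auto
    ultimately show ?thesis using real by (auto intro: order_trans)
  qed (use z in auto)
qed

lemma Liminf_nonneg:
  fixes X :: "'x \<Rightarrow> real"
  assumes "eventually (\<lambda>x. 0 \<le> X x) F"
  shows "0 \<le> Liminf F (\<lambda>x. ereal (X x))"
  using assms by (intro Liminf_bounded) (auto elim: eventually_mono)

lemma Limsup_nonneg:
  fixes X :: "'x \<Rightarrow> real"
  assumes "F \<noteq> bot" "eventually (\<lambda>x. 0 \<le> X x) F"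
  shows "0 \<le> Limsup F (\<lambda>x. ereal (X x))"
  using Liminf_nonneg[OF assms(2)] Liminf_le_Limsup[OF assms(1)] order_trans by blast

section \<open>Products of eventually nonnegative functions\<close>

context
  fixes F :: "'x filter" and X Y :: "'x \<Rightarrow> real"
  assumes F: "F \<noteq> bot"
    and X: "eventually (\<lambda>x. 0 \<le> X x) F" and Y: "eventually (\<lambda>x. 0 \<le> Y x) F"
begin

private lemma XY: "eventually (\<lambda>x. 0 \<le> X x * Y x) F"
  using X Y by eventually_elim simp

lemma Liminf_mult_ge:
  "Liminf F (\<lambda>x. ereal (X x)) * Liminf F (\<lambda>x. ereal (Y x)) \<le> Liminf F (\<lambda>x. ereal (X x * Y x))"
proof (rule ereal_mult_le_by_approx)
  fix x y :: real
  assume xy: "0 < x" "0 < y" "ereal x < Liminf F (\<lambda>x. ereal (X x))"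
    "ereal y < Liminf F (\<lambda>x. ereal (Y x))"
  show "ereal (x * y) \<le> Liminf F (\<lambda>x. ereal (X x * Y x))"
  proof (rule Liminf_bounded)
    show "\<forall>\<^sub>F n in F. ereal (x * y) \<le> ereal (X n * Y n)"
      using less_LiminfD[OF xy(3)] less_LiminfD[OF xy(4)] X Y
      by eventually_elim (use xy in \<open>auto intro!: mult_mono\<close>)
  qed
qed (intro Liminf_nonneg F X Y XY)+

lemma Limsup_mult_le:
  fixes LX LY :: ereal
  defines "LX \<equiv> Limsup F (\<lambda>x. ereal (X x))" and "LY \<equiv> Limsup F (\<lambda>x. ereal (Y x))"
  assumes "\<not> (LX = 0 \<and> LY = \<infinity>)" "\<not> (LX = \<infinity> \<and> LY = 0)"
  shows "Limsup F (\<lambda>x. ereal (X x * Y x)) \<le> LX * LY"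
proof (rule ereal_le_mult_by_approx)
  fix x y :: real
  assume xy: "0 < x" "0 < y" "LX < ereal x" "LY < ereal y"
  show "Limsup F (\<lambda>x. ereal (X x * Y x)) \<le> ereal (x * y)"
  proof (rule Limsup_bounded)
    show "\<forall>\<^sub>F n in F. ereal (X n * Y n) \<le> ereal (x * y)"
      using Limsup_lessD[OF xy(3)[unfolded LX_def]] Limsup_lessD[OF xy(4)[unfolded LY_def]] X Y
      by eventually_elim (use xy in \<open>auto intro!: mult_mono\<close>)
  qed
qed (use assms Limsup_nonneg[OF F X] Limsup_nonneg[OF F Y] Liminf_nonneg[OF X] in auto)

text \<open>If the product stayed below \<open>x * y\<close> while \<open>Y\<close> eventually
  exceeds \<open>y\<close>, then \<open>X\<close> would eventually stay below \<open>x\<close>,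
  against \<open>x < Limsup X\<close>.\<close>

lemma Limsup_mult_ge:
  "Limsup F (\<lambda>x. ereal (X x)) * Liminf F (\<lambda>x. ereal (Y x)) \<le> Limsup F (\<lambda>x. ereal (X x * Y x))"
proof (rule ereal_mult_le_by_approx)
  fix x y :: real
  assume xy: "0 < x" "0 < y" "ereal x < Limsup F (\<lambda>x. ereal (X x))"
    "ereal y < Liminf F (\<lambda>x. ereal (Y x))"
  show "ereal (x * y) \<le> Limsup F (\<lambda>x. ereal (X x * Y x))"
  proof (rule ccontr)
    assume "\<not> ?thesis"
    then have lt: "Limsup F (\<lambda>x. ereal (X x * Y x)) < ereal (x * y)" by simp
    have "\<forall>\<^sub>F n in F. ereal (X n) \<le> ereal x"
      using Limsup_lessD[OF lt] less_LiminfD[OF xy(4)] X Y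
    proof eventually_elim
      case (elim n)
      show ?case
      proof (rule ccontr)
        assume "\<not> ?case"
        then have "x * y \<le> X n * Y n" using elim xy by (intro mult_mono) auto
        then show False using elim by simp
      qed
    qed
    then have "Limsup F (\<lambda>x. ereal (X x)) \<le> ereal x" by (rule Limsup_bounded)
    then show False using xy by simp
  qed
qed (intro Liminf_nonneg Limsup_nonneg F X Y XY)+

text \<open>Same contradiction with the inequalities reversed: a product above \<open>x * y\<close>
  with \<open>Y\<close> eventually below \<open>y\<close> forces \<open>X\<close> to be eventually
  at least \<open>x\<close>.\<close>

lemma Liminf_mult_le:
  fixes LX LY :: ereal
  defines "LX \<equiv> Liminf F (\<lambda>x. ereal (X x))" and "LY \<equiv> Limsup F (\<lambda>x. ereal (Y x))"
  assumes "\<not> (LX = 0 \<and> LY = \<infinity>)" "\<not> (LX = \<infinity> \<and> LY = 0)"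
  shows "Liminf F (\<lambda>x. ereal (X x * Y x)) \<le> LX * LY"
proof (rule ereal_le_mult_by_approx)
  fix x y :: real
  assume xy: "0 < x" "0 < y" "LX < ereal x" "LY < ereal y"
  show "Liminf F (\<lambda>x. ereal (X x * Y x)) \<le> ereal (x * y)"
  proof (rule ccontr)
    assume "\<not> ?thesis"
    then have lt: "ereal (x * y) < Liminf F (\<lambda>x. ereal (X x * Y x))" by simp
    have "\<forall>\<^sub>F n in F. ereal x \<le> ereal (X n)"
      using less_LiminfD[OF lt] Limsup_lessD[OF xy(4)[unfolded LY_def]] X Y
    proof eventually_elim
      case (elim n)
      show ?case
      proof (rule ccontr)
        assume "\<not> ?case"
        then have "X n * Y n \<le> x * y" using elim xy by (intro mult_mono) auto
        then show False using elim by simp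
      qed
    qed
    then have "ereal x \<le> LX" unfolding LX_def by (rule Liminf_bounded)
    then show False using xy by simp
  qed
qed (use assms Limsup_nonneg[OF F X] Limsup_nonneg[OF F Y] Liminf_nonneg[OF X] in auto)

end

section \<open>Reciprocals of eventually positive functions\<close>

context
  fixes F :: "'x filter" and X :: "'x \<Rightarrow> real"
  assumes F: "F \<noteq> bot" and X: "eventually (\<lambda>x. 0 < X x) F"
begin

private lemma X_nonneg: "eventually (\<lambda>x. 0 \<le> X x) F"
  using X by eventually_elim simp

private lemma inv_nonneg: "eventually (\<lambda>x. 0 \<le> inverse (X x)) F"
  using X by eventually_elim simp

lemma Liminf_inverse_ge:
  "inverse (Limsup F (\<lambda>x. ereal (X x))) \<le> Liminf F (\<lambda>x. ereal (inverse (X x)))"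
  (is "inverse ?L \<le> ?R")
proof (rule dense_le)
  fix y assume y: "y < inverse ?L"
  have L: "0 \<le> ?L" by (rule Limsup_nonneg[OF F X_nonneg])
  show "y \<le> ?R"
  proof (cases "y \<le> 0")
    case True
    then show ?thesis using Liminf_nonneg[OF inv_nonneg] by (rule order_trans)
  next
    case False
    then obtain y' where y': "y = ereal y'" "0 < y'" using y by (cases y) auto
    have "?L < ereal (inverse y')"
      using y L y' by (cases ?L) (auto simp: field_simps split: if_splits)
    from Limsup_lessD[OF this] X
    have "\<forall>\<^sub>F n in F. y \<le> ereal (inverse (X n))"
      by eventually_elim (use y' in \<open>auto simp: field_simps\<close>)
    then show ?thesis by (rule Liminf_bounded)
  qed
qed

lemma Limsup_inverse_le:
  "Limsup F (\<lambda>x. ereal (inverse (X x))) \<le> inverse (Liminf F (\<lambda>x. ereal (X x)))"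
  (is "?R \<le> inverse ?L")
proof (rule dense_ge)
  fix y assume y: "inverse ?L < y"
  have L: "0 \<le> ?L" by (rule Liminf_nonneg[OF X_nonneg])
  show "?R \<le> y"
  proof (cases y)
    case (real y')
    have "0 \<le> inverse ?L" using L by (cases ?L) auto
    then have "0 < y" using y by simp
    then have y': "0 < y'" using real by simp
    have "ereal (inverse y') < ?L"
    proof (rule ccontr)
      assume "\<not> ?thesis"
      then have "inverse (ereal (inverse y')) \<le> inverse ?L"
        using L by (intro ereal_inverse_antimono) auto
      then show False using y y' real by simp
    qed
    from less_LiminfD[OF this] X
    have "\<forall>\<^sub>F n in F. ereal (inverse (X n)) \<le> y"
      by eventually_elim (use y' real in \<open>auto simp: field_simps\<close>)
    then show ?thesis by (rule Limsup_bounded)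
  qed (use y in auto)
qed

end

text \<open>The estimates above are one-sided. Applied to \<open>1 / X\<close> in place of
  \<open>X\<close>, followed by inversion, which is an antitone involution of
  \<open>[0, \<infinity>]\<close>, they give the reverse inequalities.\<close>

lemma
  fixes F :: "'x filter" and X :: "'x \<Rightarrow> real"
  assumes F: "F \<noteq> bot" and X: "eventually (\<lambda>x. 0 < X x) F"
  shows Liminf_inverse_pos:
      "Liminf F (\<lambda>x. ereal (inverse (X x))) = inverse (Limsup F (\<lambda>x. ereal (X x)))"
    and Limsup_inverse_pos:
      "Limsup F (\<lambda>x. ereal (inverse (X x))) = inverse (Liminf F (\<lambda>x. ereal (X x)))"
proof -
  let ?Y = "\<lambda>x. inverse (X x)"
  have Y: "eventually (\<lambda>x. 0 < ?Y x) F"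
    using X by eventually_elim simp
  have nonneg: "eventually (\<lambda>x. 0 \<le> X x) F" "eventually (\<lambda>x. 0 \<le> ?Y x) F"
    using X by (auto elim: eventually_mono)
  have inverse_inverse: "inverse (inverse z) = z" if "0 \<le> z" for z :: ereal
    using that by (cases z) auto
  have "inverse (inverse (Liminf F (\<lambda>x. ereal (?Y x)))) \<le> inverse (Limsup F (\<lambda>x. ereal (X x)))"
    using Limsup_inverse_le[OF F Y] by (intro ereal_inverse_antimono Limsup_nonneg F nonneg) simp
  then show "Liminf F (\<lambda>x. ereal (?Y x)) = inverse (Limsup F (\<lambda>x. ereal (X x)))"
    using Liminf_inverse_ge[OF F X] Liminf_nonneg[OF nonneg(2)]
    by (auto simp: inverse_inverse intro: antisym)
  have "inverse (Liminf F (\<lambda>x. ereal (X x))) \<le> inverse (inverse (Limsup F (\<lambda>x. ereal (?Y x))))"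
    using Liminf_inverse_ge[OF F Y] Limsup_nonneg[OF F nonneg(2)]
    by (intro ereal_inverse_antimono) (auto simp: ereal_inverse_nonneg_iff)
  then show "Limsup F (\<lambda>x. ereal (?Y x)) = inverse (Liminf F (\<lambda>x. ereal (X x)))"
    using Limsup_inverse_le[OF F X] Limsup_nonneg[OF F nonneg(2)]
    by (auto simp: inverse_inverse intro: antisym)
qed

section \<open>Roots on the extended nonnegative reals\<close>

lemma eroot_mono:
  assumes "0 < real_of_ereal e" "0 \<le> x" "x \<le> y"
  shows "eroot e x \<le> eroot e y"
  using assms unfolding eroot_def
  by (cases x; cases y) (auto intro!: powr_mono2)

text \<open>\<open>eroot (ereal (1 / a))\<close> is the \<open>a\<close>-th power, hence it is
  undone by the \<open>a\<close>-th root.\<close>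

lemma eroot_eroot_inverse:
  assumes "0 < a" "0 \<le> x"
  shows "eroot (ereal a) (eroot (ereal (1 / a)) x) = x"
  using assms unfolding eroot_def by (cases x) (auto simp: powr_powr)

lemma eroot_nonneg: "0 \<le> eroot e x"
  by (simp add: eroot_def)

lemma Liminf_powr_ge:
  assumes F: "F \<noteq> bot" and a: "0 < a" and X: "eventually (\<lambda>x. 0 \<le> X x) F"
  shows "eroot (ereal a) (Liminf F (\<lambda>x. ereal (X x))) \<le> Liminf F (\<lambda>x. ereal (X x powr (1 / a)))"
    (is "eroot _ ?L \<le> ?R")
proof (rule dense_le)
  fix y assume y: "y < eroot (ereal a) ?L"
  have L: "0 \<le> ?L" by (rule Liminf_nonneg[OF X])
  show "y \<le> ?R"
  proof (cases "y \<le> 0")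
    case True
    have "0 \<le> ?R" by (rule Liminf_nonneg) simp
    with True show ?thesis by (rule order_trans)
  next
    case False
    then obtain y' where y': "y = ereal y'" "0 < y'" using y by (cases y) auto
    have "ereal (y' powr a) < ?L"
    proof (rule ccontr)
      assume "\<not> ?thesis"
      then have "eroot (ereal a) ?L \<le> eroot (ereal a) (ereal (y' powr a))"
        using a L by (intro eroot_mono) auto
      also have "\<dots> = y" using y' a by (simp add: eroot_def powr_powr)
      finally show False using y by simp
    qed
    from less_LiminfD[OF this] X
    have "\<forall>\<^sub>F n in F. y \<le> ereal (X n powr (1 / a))"
    proof eventually_elim
      case (elim n)
      have "(y' powr a) powr (1 / a) \<le> X n powr (1 / a)" using elim a by (intro powr_mono2) auto
      then show ?case using y' a by (simp add: powr_powr)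
    qed
    then show ?thesis by (rule Liminf_bounded)
  qed
qed

lemma Limsup_powr_le:
  assumes F: "F \<noteq> bot" and a: "0 < a" and X: "eventually (\<lambda>x. 0 \<le> X x) F"
  shows "Limsup F (\<lambda>x. ereal (X x powr (1 / a))) \<le> eroot (ereal a) (Limsup F (\<lambda>x. ereal (X x)))"
    (is "?R \<le> eroot _ ?L")
proof (rule dense_ge)
  fix y assume y: "eroot (ereal a) ?L < y"
  have L: "0 \<le> ?L" by (rule Limsup_nonneg[OF F X])
  show "?R \<le> y"
  proof (cases y)
    case (real y')
    have y': "0 < y'" using y real eroot_nonneg[of "ereal a" ?L]
      by (metis ereal_less(2) order_le_less_trans)
    have "?L < ereal (y' powr a)"
    proof (rule ccontr)
      assume "\<not> ?thesis"
      then have "eroot (ereal a) (ereal (y' powr a)) \<le> eroot (ereal a) ?L"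
        using a by (intro eroot_mono) auto
      moreover have "eroot (ereal a) (ereal (y' powr a)) = y"
        using y' a real by (simp add: eroot_def powr_powr)
      ultimately show False using y by simp
    qed
    from Limsup_lessD[OF this] X
    have "\<forall>\<^sub>F n in F. ereal (X n powr (1 / a)) \<le> y"
    proof eventually_elim
      case (elim n)
      have "X n powr (1 / a) \<le> (y' powr a) powr (1 / a)" using elim a by (intro powr_mono2) auto
      then show ?case using y' a real by (simp add: powr_powr)
    qed
    then show ?thesis by (rule Limsup_bounded)
  qed (use y in auto)
qed

text \<open>The one-sided estimates are applied a second time to \<open>Y = X powr (1 / a)\<close>
  with exponent \<open>1 / a\<close>, whose root recovers \<open>X\<close>; taking
  \<open>a\<close>-th roots of the outcome yields the reverse inequalities.\<close>

lemma
  assumes F: "F \<noteq> bot" and a: "0 < a" and X: "eventually (\<lambda>x. 0 \<le> X x) F"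
  shows Liminf_powr: "Liminf F (\<lambda>x. ereal (X x powr (1 / a))) = eroot (ereal a) (Liminf F (\<lambda>x. ereal (X x)))"
    and Limsup_powr: "Limsup F (\<lambda>x. ereal (X x powr (1 / a))) = eroot (ereal a) (Limsup F (\<lambda>x. ereal (X x)))"
proof -
  let ?Y = "\<lambda>x. X x powr (1 / a)"
  have Y: "eventually (\<lambda>x. 0 \<le> ?Y x) F" by simp
  have YX: "\<forall>\<^sub>F x in F. ereal (?Y x powr (1 / (1 / a))) = ereal (X x)"
    using X by eventually_elim (use a in \<open>auto simp: powr_powr\<close>)
  have "eroot (ereal (1 / a)) (Liminf F (\<lambda>x. ereal (?Y x))) \<le> Liminf F (\<lambda>x. ereal (X x))"
    using Liminf_powr_ge[OF F _ Y, of "1 / a"] a unfolding Liminf_eq[OF YX] by simp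
  then have "eroot (ereal a) (eroot (ereal (1 / a)) (Liminf F (\<lambda>x. ereal (?Y x)))) \<le>
      eroot (ereal a) (Liminf F (\<lambda>x. ereal (X x)))"
    using a by (intro eroot_mono eroot_nonneg) auto
  then show "Liminf F (\<lambda>x. ereal (?Y x)) = eroot (ereal a) (Liminf F (\<lambda>x. ereal (X x)))"
    using Liminf_powr_ge[OF F a X] a Liminf_nonneg[OF Y]
    by (auto simp: eroot_eroot_inverse intro: antisym)
  have "Limsup F (\<lambda>x. ereal (X x)) \<le> eroot (ereal (1 / a)) (Limsup F (\<lambda>x. ereal (?Y x)))"
    using Limsup_powr_le[OF F _ Y, of "1 / a"] a unfolding Limsup_eq[OF YX] by simp
  then have "eroot (ereal a) (Limsup F (\<lambda>x. ereal (X x))) \<le>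
      eroot (ereal a) (eroot (ereal (1 / a)) (Limsup F (\<lambda>x. ereal (?Y x))))"
    using a by (intro eroot_mono Limsup_nonneg[OF F X]) auto
  then show "Limsup F (\<lambda>x. ereal (?Y x)) = eroot (ereal a) (Limsup F (\<lambda>x. ereal (X x)))"
    using Limsup_powr_le[OF F a X] a Limsup_nonneg[OF F Y]
    by (auto simp: eroot_eroot_inverse intro: antisym)
qed

section \<open>The maximum modulus of a vector valued Dirichlet series\<close>

lemma bounded_linear_scaleC_left: "bounded_linear (\<lambda>c. c *\<^sub>C (x :: 'a::complex_banach))"
proof (rule bounded_linear_intro[where K = "norm x"])
  fix r c
  show "(r *\<^sub>R c) *\<^sub>C x = r *\<^sub>R (c *\<^sub>C x)"
    by (metis scaleC_of_real scaleC_scaleC scaleR_conv_of_real)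
qed (simp_all add: scaleC_add_left norm_scaleC)

lemma bounded_linear_scaleC_right: "bounded_linear (\<lambda>x. c *\<^sub>C (x :: 'a::complex_banach))"
proof (rule bounded_linear_intro[where K = "cmod c"])
  fix r and x :: 'a
  show "c *\<^sub>C (r *\<^sub>R x) = r *\<^sub>R (c *\<^sub>C x)"
    by (metis scaleC_of_real scaleC_scaleC mult.commute)
qed (simp_all add: scaleC_add_right norm_scaleC mult.commute)

section \<open>Maximum principle in left half planes\<close>

text \<open>Cauchy's formula at the centre: along the circle the derivative of the path is
  \<open>2 * pi * \<i>\<close> times \<open>circlepath z r x - z\<close>, which cancels the
  denominator.\<close>

lemma has_integral_circle_mean:
  assumes "\<phi> holomorphic_on cball z r" "0 < r"
  shows "((\<lambda>x. \<phi> (circlepath z r x)) has_integral \<phi> z) {0..1}"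
proof -
  have "((\<lambda>x. \<phi> (circlepath z r x) / (circlepath z r x - z) *
      vector_derivative (circlepath z r) (at x within {0..1})) has_integral (2 * of_real pi * \<i> * \<phi> z)) {0..1}"
    using Cauchy_integral_circlepath_simple[OF assms(1), of z] assms(2)
    unfolding has_contour_integral_def by simp
  then have "((\<lambda>x. 2 * of_real pi * \<i> * \<phi> (circlepath z r x)) has_integral (2 * of_real pi * \<i> * \<phi> z)) {0..1}"
  proof (rule has_integral_eq[rotated])
    fix x :: real assume "x \<in> {0..1}"
    then show "\<phi> (circlepath z r x) / (circlepath z r x - z) *
        vector_derivative (circlepath z r) (at x within {0..1}) = 2 * of_real pi * \<i> * \<phi> (circlepath z r x)"
      using assms(2) vector_derivative_circlepath01[of x z r] by (simp add: circlepath field_simps)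
  qed
  then show ?thesis by (subst (asm) has_integral_mult_right_iff) simp_all
qed

text \<open>The mean value property holds for each scalar \<open>\<phi> n\<close> and passes to the
  vector valued sum by linearity. The norm at the centre is thus at most the mean of the norms on
  the circle, so the continuous nonnegative difference has integral zero and vanishes.\<close>

lemma norm_eq_on_circle_of_maximal_centre:
  fixes b :: "'i \<Rightarrow> 'a::complex_banach"
  assumes I: "finite I" and hol: "\<And>n. n \<in> I \<Longrightarrow> \<phi> n holomorphic_on cball z r" and r: "0 < r"
    and max: "\<And>w. w \<in> sphere z r \<Longrightarrow> norm (\<Sum>n\<in>I. \<phi> n w *\<^sub>C b n) \<le> norm (\<Sum>n\<in>I. \<phi> n z *\<^sub>C b n)"
    and w: "w \<in> sphere z r"
  shows "norm (\<Sum>n\<in>I. \<phi> n w *\<^sub>C b n) = norm (\<Sum>n\<in>I. \<phi> n z *\<^sub>C b n)"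
proof -
  define F where "F w = (\<Sum>n\<in>I. \<phi> n w *\<^sub>C b n)" for w
  let ?c = "circlepath z r"
  have int: "((\<lambda>x. F (?c x)) has_integral F z) {0..1}"
    unfolding F_def using has_integral_linear[OF has_integral_circle_mean[OF hol r] bounded_linear_scaleC_left]
    by (intro has_integral_sum I) (auto simp: o_def)
  have circle: "?c x \<in> sphere z r" if "x \<in> {0..1}" for x
    using that path_image_circlepath_nonneg[of r z] r by (auto simp: path_image_def)
  have "continuous_on (sphere z r) F"
    unfolding F_def
    by (intro continuous_on_sum bounded_linear.continuous_on[OF bounded_linear_scaleC_left]
        holomorphic_on_imp_continuous_on holomorphic_on_subset[OF hol]) auto
  then have cont: "continuous_on {0..1} (\<lambda>x. F (?c x))"
    by (rule continuous_on_compose2) (use circle in \<open>auto intro: path_circlepath[unfolded path_def]\<close>)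
  have "norm (F z) \<le> integral {0..1} (\<lambda>x. norm (F (?c x)))"
    using integral_norm_bound_integral[OF integrable_continuous_real[OF cont]
        integrable_continuous_real[OF continuous_on_norm[OF cont]]] integral_unique[OF int] by simp
  moreover have "integral {0..1} (\<lambda>x. norm (F z) - norm (F (?c x))) =
      norm (F z) - integral {0..1} (\<lambda>x. norm (F (?c x)))"
    by (subst integral_diff) (auto intro!: integrable_continuous_real continuous_intros cont)
  moreover have nonneg: "0 \<le> norm (F z) - norm (F (?c x))" if "x \<in> {0..1}" for x
    using max[OF circle[OF that]] by (simp add: F_def)
  moreover have contd: "continuous_on {0..1} (\<lambda>x. norm (F z) - norm (F (?c x)))"
    by (intro continuous_intros cont)
  then have "0 \<le> integral {0..1} (\<lambda>x. norm (F z) - norm (F (?c x)))"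
    by (intro integral_nonneg integrable_continuous_real nonneg) auto
  ultimately have "integral {0..1} (\<lambda>x. norm (F z) - norm (F (?c x))) = 0" by linarith
  then have zero: "\<forall>x\<in>{0..1}. norm (F z) - norm (F (?c x)) = 0"
    using integral_eq_0_iff[OF contd] nonneg by simp
  have "w \<in> ?c ` {0..1}"
    using w path_image_circlepath_nonneg[of r z] r unfolding path_image_def by simp
  then obtain x where "x \<in> {0..1}" "w = ?c x" by blast
  with zero show ?thesis by (auto simp: F_def)
qed

text \<open>Partial sums: the maximum principle is proved for them first, since there only scalar
  coefficients have to be holomorphic; a tail estimate then reaches the series.\<close>

definition dir_sum :: "(nat \<Rightarrow> real) \<Rightarrow> (nat \<Rightarrow> 'a::complex_banach) \<Rightarrow> nat \<Rightarrow> complex \<Rightarrow> 'a"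
  where "dir_sum k b N s = (\<Sum>n<N. exp (s * complex_of_real (k n)) *\<^sub>C b n)"

text \<open>Dividing by \<open>1 + \<epsilon> (\<sigma> - s)\<close> makes the norm attain its maximum over the half plane; if the
  maximum is attained inside, the circle around that point touching the boundary line carries it
  to the boundary.\<close>

lemma dir_sum_half_plane_weighted:
  fixes b :: "nat \<Rightarrow> 'a::complex_banach"
  assumes k: "\<And>n. 0 \<le> k n" and bound: "\<And>t. norm (dir_sum k b N (Complex \<sigma> t)) \<le> B"
    and e: "0 < e" and s: "Re s \<le> \<sigma>"
  shows "norm (dir_sum k b N s) \<le> B * cmod (1 + of_real e * (of_real \<sigma> - s))"
proof -
  define d where "d s = 1 + of_real e * (of_real \<sigma> - s)" for s :: complex
  define \<phi> where "\<phi> n s = exp (s * complex_of_real (k n)) / d s" for n s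
  define F where "F s = (\<Sum>n<N. \<phi> n s *\<^sub>C b n)" for s
  define C where "C = (\<Sum>n<N. exp (\<sigma> * k n) * norm (b n))"
  define H where "H = {s. Re s \<le> \<sigma>}"
  have B: "0 \<le> B" using order_trans[OF norm_ge_zero bound] .
  have Re_d: "1 \<le> Re (d w)" if "w \<in> H" for w
    using that e by (simp add: d_def H_def)
  have d_ge: "1 \<le> cmod (d w)" if "w \<in> H" for w
    using Re_d[OF that] complex_Re_le_cmod[of "d w"] by linarith
  have d_nz: "d w \<noteq> 0" if "w \<in> H" for w
    using d_ge[OF that] by auto
  have F: "dir_sum k b N w = d w *\<^sub>C F w" if "w \<in> H" for w
    unfolding dir_sum_def F_def
    by (subst linear_sum[OF bounded_linear.linear[OF bounded_linear_scaleC_right]])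
      (simp add: scaleC_scaleC \<phi>_def d_nz[OF that])
  then have norm_F: "norm (dir_sum k b N w) = cmod (d w) * norm (F w)" if "w \<in> H" for w
    using that by (simp add: norm_scaleC)
  have C: "norm (dir_sum k b N w) \<le> C" if "w \<in> H" for w
    unfolding dir_sum_def C_def
    by (rule sum_norm_le) (use that k in \<open>auto simp: norm_scaleC H_def intro!: mult_right_mono\<close>)
  have line: "norm (F w) \<le> B" if "Re w = \<sigma>" for w
  proof -
    have w: "w \<in> H" using that by (simp add: H_def)
    have "norm (F w) \<le> cmod (d w) * norm (F w)"
      using mult_right_mono[OF d_ge[OF w], of "norm (F w)"] by simp
    also have "\<dots> \<le> B" using norm_F[OF w] bound[of "Im w"] that by (metis complex_surj)
    finally show ?thesis .
  qed
  have hol: "\<phi> n holomorphic_on H" for n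
    unfolding \<phi>_def using d_nz by (auto simp: d_def intro!: holomorphic_intros)
  have "norm (F s) \<le> B"
  proof (rule ccontr)
    assume "\<not> ?thesis"
    with B have large: "B < norm (F s)" "0 < norm (F s)" by auto
    \<comment> \<open>Beyond this radius \<open>cmod (d w)\<close> is at least
      \<open>C / norm (F s)\<close>, so the bound \<open>C\<close> on the unweighted sum gives
      \<open>norm (F w) \<le> norm (F s)\<close>. The summand \<open>norm s\<close> keeps
      \<open>s\<close> inside the disc, and the maximum over the compact set \<open>K\<close> is one
      over \<open>H\<close>.\<close>
    define R where "R = \<bar>\<sigma>\<bar> + norm s + (C / norm (F s) + 1) / e"
    define K where "K = H \<inter> cball 0 R"
    have "0 \<le> C" by (auto simp: C_def intro!: sum_nonneg)
    then have "norm s \<le> R" using e large by (auto simp: R_def)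
    then have sK: "s \<in> K" using s by (auto simp: K_def H_def)
    have "compact K" unfolding K_def H_def
      by (intro closed_Int_compact compact_cball closed_halfspace_Re_le)
    moreover have "continuous_on K (\<lambda>w. norm (F w))"
      unfolding F_def
      by (intro continuous_on_norm continuous_on_sum bounded_linear.continuous_on[OF bounded_linear_scaleC_left]
          holomorphic_on_imp_continuous_on holomorphic_on_subset[OF hol]) (auto simp: K_def)
    ultimately obtain z where z: "z \<in> K" and zmax: "\<And>w. w \<in> K \<Longrightarrow> norm (F w) \<le> norm (F z)"
      using continuous_attains_sup[of K "\<lambda>w. norm (F w)"] sK by blast
    have far: "norm (F w) \<le> norm (F s)" if "w \<in> H" "w \<notin> K" for w
    proof -
      have "R < norm w" using that by (auto simp: K_def)
      have "e * (norm w - \<bar>\<sigma>\<bar>) \<le> cmod (of_real e * (of_real \<sigma> - w))"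
        using e norm_triangle_ineq2[of w "of_real \<sigma>"]
        by (simp add: norm_mult norm_minus_commute)
      also have "\<dots> \<le> cmod (d w) + 1"
        using norm_triangle_ineq4[of "d w" 1] by (simp add: d_def)
      finally have "e * (norm w - \<bar>\<sigma>\<bar>) \<le> cmod (d w) + 1" .
      moreover have "(C / norm (F s) + 1) / e \<le> norm w - \<bar>\<sigma>\<bar>"
        using \<open>R < norm w\<close> norm_ge_zero[of s] unfolding R_def by linarith
      then have "C / norm (F s) + 1 \<le> e * (norm w - \<bar>\<sigma>\<bar>)"
        using e by (simp add: field_simps)
      ultimately have "C / norm (F s) \<le> cmod (d w)" by linarith
      then have "C \<le> cmod (d w) * norm (F s)" using large by (simp add: field_simps)
      moreover have "cmod (d w) * norm (F w) \<le> C" using C[OF that(1)] norm_F[OF that(1)] by simp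
      ultimately have "cmod (d w) * norm (F w) \<le> cmod (d w) * norm (F s)" by linarith
      then show ?thesis using d_nz[OF that(1)] by (simp add: mult_le_cancel_left)
    qed
    have max: "norm (F w) \<le> norm (F z)" if "w \<in> H" for w
      using far[OF that] zmax[OF sK] zmax[of w] by fastforce
    have "norm (F z) \<le> B"
    proof (cases "Re z = \<sigma>")
      case False
      define r where "r = \<sigma> - Re z"
      have r: "0 < r" using False z by (auto simp: r_def K_def H_def)
      have sub: "cball z r \<subseteq> H"
      proof
        fix w assume "w \<in> cball z r"
        then have "Re w - Re z \<le> r"
          using complex_Re_le_cmod[of "w - z"] by (auto simp: dist_norm norm_minus_commute)
        then show "w \<in> H" by (simp add: r_def H_def)
      qed
      have "norm (F (z + of_real r)) = norm (F z)"
        unfolding F_def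
        by (rule norm_eq_on_circle_of_maximal_centre[where r = r])
          (use r max[unfolded F_def] sub in \<open>auto simp: dist_norm intro: holomorphic_on_subset[OF hol]\<close>)
      moreover have "Re (z + of_real r) = \<sigma>" by (simp add: r_def)
      ultimately show ?thesis using line by metis
    qed (use line in simp)
    then show False using max[of s] large s by (auto simp: H_def)
  qed
  then have "norm (dir_sum k b N s) \<le> cmod (d s) * B"
    using s by (subst norm_F) (auto simp: H_def intro: mult_left_mono)
  then show ?thesis by (simp add: d_def mult.commute)
qed

text \<open>The weight tends to 1 as its parameter \<open>e\<close> decreases to 0.\<close>

lemma dir_sum_half_plane_bound:
  fixes b :: "nat \<Rightarrow> 'a::complex_banach"
  assumes k: "\<And>n. 0 \<le> k n" and bound: "\<And>t. norm (dir_sum k b N (Complex \<sigma> t)) \<le> B"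
    and s: "Re s \<le> \<sigma>"
  shows "norm (dir_sum k b N s) \<le> B"
proof -
  have "((\<lambda>e. B * cmod (1 + of_real e * (of_real \<sigma> - s))) \<longlongrightarrow> B * cmod (1 + of_real 0 * (of_real \<sigma> - s))) (at_right 0)"
    by (intro tendsto_intros)
  moreover have "\<forall>\<^sub>F e in at_right 0. norm (dir_sum k b N s) \<le> B * cmod (1 + of_real e * (of_real \<sigma> - s))"
    using dir_sum_half_plane_weighted[OF k bound _ s] by (auto simp: eventually_at_filter)
  ultimately have "norm (dir_sum k b N s) \<le> B * cmod (1 + of_real 0 * (of_real \<sigma> - s))"
    by (intro tendsto_lowerbound) auto
  then show ?thesis by simp
qed


text \<open>As the exponents are nonnegative, the tail \<open>T N\<close> taken on the line bounds
  the remainder in the whole half plane. The partial sum is at most \<open>B + T N\<close> on the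
  line, hence to its left, and returning to \<open>f\<close> costs another
  \<open>T N\<close>.\<close>

lemma dirichlet_half_plane_bound:
  fixes b :: "nat \<Rightarrow> 'a::complex_banach"
  assumes k: "\<And>n. 0 \<le> k n" and summ: "summable (\<lambda>n. exp (\<sigma> * k n) * norm (b n))"
    and f: "\<And>s. (\<lambda>n. exp (s * complex_of_real (k n)) *\<^sub>C b n) sums f s"
    and bound: "\<And>t. norm (f (Complex \<sigma> t)) \<le> B"
    and s: "Re s \<le> \<sigma>"
  shows "norm (f s) \<le> B"
proof -
  define T where "T N = (\<Sum>n. exp (\<sigma> * k (n + N)) * norm (b (n + N)))" for N
  have T: "T \<longlonglongrightarrow> 0"
    unfolding T_def by (rule suminf_exist_split2[OF summ])
  have tail: "norm (f w - dir_sum k b N w) \<le> T N" if "Re w \<le> \<sigma>" for w N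
  proof -
    have "(\<lambda>n. exp (w * complex_of_real (k (n + N))) *\<^sub>C b (n + N)) sums (f w - dir_sum k b N w)"
      unfolding dir_sum_def by (rule sums_split_initial_segment[OF f])
    then have "f w - dir_sum k b N w = (\<Sum>n. exp (w * complex_of_real (k (n + N))) *\<^sub>C b (n + N))"
      by (rule sums_unique)
    also have "norm \<dots> \<le> T N"
      unfolding T_def
      by (rule norm_suminf_le)
        (use that k summ in \<open>auto simp: norm_scaleC intro!: mult_right_mono summable_ignore_initial_segment
          [of "\<lambda>n. exp (\<sigma> * k n) * norm (b n)"]\<close>)
    finally show ?thesis .
  qed
  have "norm (f s) \<le> B + 2 * T N" for N
  proof -
    have "norm (dir_sum k b N (Complex \<sigma> t)) \<le> B + T N" for t
      using tail[of "Complex \<sigma> t" N] bound[of t]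
        norm_triangle_ineq4[of "f (Complex \<sigma> t)" "f (Complex \<sigma> t) - dir_sum k b N (Complex \<sigma> t)"] by simp
    then have "norm (dir_sum k b N s) \<le> B + T N"
      by (intro dir_sum_half_plane_bound[OF k _ s])
    then show ?thesis
      using tail[OF s, of N] norm_triangle_ineq[of "f s - dir_sum k b N s" "dir_sum k b N s"] by simp
  qed
  moreover have "(\<lambda>N. B + 2 * T N) \<longlonglongrightarrow> B + 2 * 0"
    by (intro tendsto_intros T)
  ultimately show ?thesis by (intro tendsto_lowerbound[of _ B]) auto
qed

section \<open>Growth, continuity and range of the maximum modulus\<close>

text \<open>A normal form of the series in \<open>vvds\<close>: indexed from 0, starting at a
  nonzero coefficient, with absolute convergence in place of the two growth conditions.\<close>

locale dirichlet_series =
  fixes b :: "nat \<Rightarrow> 'a::complex_banach" and k :: "nat \<Rightarrow> real" and f :: "complex \<Rightarrow> 'a"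
  assumes k_pos: "\<And>n. 0 < k n" and k_strict: "strict_mono k"
    and summable_norm: "\<And>\<sigma>. summable (\<lambda>n. exp (\<sigma> * k n) * norm (b n))"
    and sums: "\<And>s. (\<lambda>n. exp (s * complex_of_real (k n)) *\<^sub>C b n) sums f s"
    and b0: "b 0 \<noteq> 0"
begin

lemma norm_le: "norm (f s) \<le> (\<Sum>n. exp (Re s * k n) * norm (b n))"
proof -
  have "f s = (\<Sum>n. exp (s * complex_of_real (k n)) *\<^sub>C b n)"
    using sums by (rule sums_unique)
  also have "norm \<dots> \<le> (\<Sum>n. exp (Re s * k n) * norm (b n))"
    by (rule norm_suminf_le) (use summable_norm in \<open>auto simp: norm_scaleC\<close>)
  finally show ?thesis .
qed

lemma bdd_above_norm: "bdd_above (range (\<lambda>t. norm (f (Complex \<sigma> t))))"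
  by (rule bdd_aboveI2[where M = "\<Sum>n. exp (\<sigma> * k n) * norm (b n)"])
    (use norm_le in \<open>metis complex.sel(1)\<close>)

lemma norm_le_max_mod: "norm (f s) \<le> max_mod f (Re s)"
  using cSUP_upper[OF UNIV_I bdd_above_norm, of "Re s" "Im s"] by (simp add: max_mod_def)

lemma max_mod_le: "(\<And>t. norm (f (Complex \<sigma> t)) \<le> B) \<Longrightarrow> max_mod f \<sigma> \<le> B"
  unfolding max_mod_def by (rule cSUP_least) auto

text \<open>Multiplying by \<open>exp (- s * k 0)\<close> turns the exponents into
  \<open>k n - k 0\<close>, still nonnegative, so the half plane bound applies to the shifted
  series. This gains an exponential factor over plain monotonicity.\<close>

lemma norm_shifted_le:
  assumes "Re s \<le> \<sigma>"
  shows "exp (- (Re s * k 0)) * norm (f s) \<le> exp (- (\<sigma> * k 0)) * max_mod f \<sigma>"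
proof -
  define g where "g s = exp (- s * complex_of_real (k 0)) *\<^sub>C f s" for s
  have g: "norm (g s) = exp (- (Re s * k 0)) * norm (f s)" for s
    by (simp add: g_def norm_scaleC)
  have "norm (g s) \<le> exp (- (\<sigma> * k 0)) * max_mod f \<sigma>"
  proof (rule dirichlet_half_plane_bound[where k = "\<lambda>n. k n - k 0" and b = b])
    show "0 \<le> k n - k 0" for n
      using strict_mono_less_eq[OF k_strict, of 0 n] by simp
    have "exp (\<sigma> * (k n - k 0)) = exp (- (\<sigma> * k 0)) * exp (\<sigma> * k n)" for n
      by (simp add: algebra_simps flip: exp_add)
    then show "summable (\<lambda>n. exp (\<sigma> * (k n - k 0)) * norm (b n))"
      using summable_mult[OF summable_norm[of \<sigma>], of "exp (- (\<sigma> * k 0))"] by (simp add: mult.assoc)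
    show "(\<lambda>n. exp (s * complex_of_real (k n - k 0)) *\<^sub>C b n) sums g s" for s
    proof -
      have "exp (s * complex_of_real (k n - k 0)) =
          exp (- s * complex_of_real (k 0)) * exp (s * complex_of_real (k n))" for n
        by (simp add: algebra_simps flip: exp_add)
      then show ?thesis
        using bounded_linear.sums[OF bounded_linear_scaleC_right sums[of s], of "exp (- s * complex_of_real (k 0))"]
        by (simp add: g_def scaleC_scaleC)
    qed
    show "norm (g (Complex \<sigma> t)) \<le> exp (- (\<sigma> * k 0)) * max_mod f \<sigma>" for t
      using norm_le_max_mod[of "Complex \<sigma> t"] by (simp add: g)
  qed (rule assms)
  then show ?thesis by (simp add: g)
qed

lemma max_mod_growth:
  assumes "\<sigma>1 \<le> \<sigma>2"
  shows "exp ((\<sigma>2 - \<sigma>1) * k 0) * max_mod f \<sigma>1 \<le> max_mod f \<sigma>2"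
proof -
  have "max_mod f \<sigma>1 \<le> exp (- ((\<sigma>2 - \<sigma>1) * k 0)) * max_mod f \<sigma>2"
  proof (rule max_mod_le)
    fix t
    have "exp (- (\<sigma>1 * k 0)) * norm (f (Complex \<sigma>1 t)) \<le> exp (- (\<sigma>2 * k 0)) * max_mod f \<sigma>2"
      using norm_shifted_le[of "Complex \<sigma>1 t" \<sigma>2] assms by simp
    then have "exp (\<sigma>1 * k 0) * (exp (- (\<sigma>1 * k 0)) * norm (f (Complex \<sigma>1 t))) \<le>
        exp (\<sigma>1 * k 0) * (exp (- (\<sigma>2 * k 0)) * max_mod f \<sigma>2)"
      by (rule mult_left_mono) simp
    then show "norm (f (Complex \<sigma>1 t)) \<le> exp (- ((\<sigma>2 - \<sigma>1) * k 0)) * max_mod f \<sigma>2"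
      by (simp add: algebra_simps flip: exp_add mult.assoc)
  qed
  then have "exp ((\<sigma>2 - \<sigma>1) * k 0) * max_mod f \<sigma>1 \<le>
      exp ((\<sigma>2 - \<sigma>1) * k 0) * (exp (- ((\<sigma>2 - \<sigma>1) * k 0)) * max_mod f \<sigma>2)"
    by (rule mult_left_mono) simp
  then show ?thesis by (simp flip: exp_add mult.assoc)
qed

text \<open>Far to the left the first term dominates: at the real point \<open>- x\<close>, after
  scaling by \<open>exp (x * k 0)\<close>, the remaining terms contribute at most
  \<open>exp (- x * c) * D\<close>, while the scaled norm of \<open>f\<close> stays below
  \<open>M\<close>. The bound follows as \<open>x\<close> tends to infinity.\<close>

lemma max_mod_ge: "norm (b 0) * exp (\<sigma> * k 0) \<le> max_mod f \<sigma>"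
proof -
  define c where "c = k 1 - k 0"
  define D where "D = (\<Sum>n. norm (b (n + 1)))"
  define M where "M = exp (- (\<sigma> * k 0)) * max_mod f \<sigma>"
  have c: "0 < c" using strict_monoD[OF k_strict, of 0 1] by (simp add: c_def)
  have summ: "summable (\<lambda>n. norm (b (n + 1)))"
    using summable_norm[of 0] by (subst summable_iff_shift) simp
  have "norm (b 0) \<le> M + exp (- x * c) * D" if x: "0 \<le> x" "- \<sigma> \<le> x" for x
  proof -
    define e where "e = exp (complex_of_real (- x) * complex_of_real (k 0))"
    have e: "cmod e = exp (- x * k 0)" by (simp add: e_def)
    have "(\<lambda>n. exp (complex_of_real (- x) * complex_of_real (k (n + 1))) *\<^sub>C b (n + 1)) sums
        (f (complex_of_real (- x)) - e *\<^sub>C b 0)"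
      using sums_split_initial_segment[OF sums[of "complex_of_real (- x)"], of 1] by (simp add: e_def)
    then have "f (complex_of_real (- x)) - e *\<^sub>C b 0 =
        (\<Sum>n. exp (complex_of_real (- x) * complex_of_real (k (n + 1))) *\<^sub>C b (n + 1))"
      by (rule sums_unique)
    also have "norm \<dots> \<le> (\<Sum>n. exp (- x * k 1) * norm (b (n + 1)))"
    proof (rule norm_suminf_le)
      fix n
      have "x * k 1 \<le> x * k (n + 1)"
        using strict_mono_less_eq[OF k_strict, of 1 "n + 1"] x by (intro mult_left_mono) auto
      then show "norm (exp (complex_of_real (- x) * complex_of_real (k (n + 1))) *\<^sub>C b (n + 1)) \<le>
          exp (- x * k 1) * norm (b (n + 1))"
        by (simp add: norm_scaleC mult_right_mono)
    qed (rule summable_mult[OF summ])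
    also have "\<dots> = exp (- x * k 1) * D"
      unfolding D_def by (rule suminf_mult[OF summ])
    finally have "norm (f (complex_of_real (- x)) - e *\<^sub>C b 0) \<le> exp (- x * k 1) * D" .
    then have "norm (e *\<^sub>C b 0) \<le> norm (f (complex_of_real (- x))) + exp (- x * k 1) * D"
      using norm_triangle_ineq4[of "f (complex_of_real (- x))" "f (complex_of_real (- x)) - e *\<^sub>C b 0"]
      by simp
    then have "exp (- x * k 0) * norm (b 0) \<le> norm (f (complex_of_real (- x))) + exp (- x * k 1) * D"
      by (simp add: norm_scaleC e)
    then have "exp (x * k 0) * (exp (- x * k 0) * norm (b 0)) \<le>
        exp (x * k 0) * (norm (f (complex_of_real (- x))) + exp (- x * k 1) * D)"
      by (rule mult_left_mono) simp
    then have "norm (b 0) \<le> exp (x * k 0) * norm (f (complex_of_real (- x))) + exp (- x * c) * D"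
      by (simp add: algebra_simps c_def flip: exp_add mult.assoc)
    then show ?thesis
      using norm_shifted_le[of "complex_of_real (- x)" \<sigma>] x by (simp add: M_def)
  qed
  then have "\<forall>\<^sub>F x in at_top. norm (b 0) \<le> M + exp (- x * c) * D"
    using eventually_ge_at_top[of "max 0 (- \<sigma>)"] by (auto elim: eventually_mono)
  moreover have "((\<lambda>x. M + exp (- x * c) * D) \<longlongrightarrow> M + 0 * D) at_top"
  proof (intro tendsto_intros filterlim_compose[OF exp_at_bot])
    show "filterlim (\<lambda>x. - x * c) at_bot at_top"
      using filterlim_tendsto_pos_mult_at_bot[OF tendsto_const c filterlim_uminus_at_bot_at_top]
      by (simp add: mult.commute)
  qed
  ultimately have "norm (b 0) \<le> M + 0 * D" by (intro tendsto_lowerbound) auto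
  then have "norm (b 0) * exp (\<sigma> * k 0) \<le> M * exp (\<sigma> * k 0)" by simp
  also have "\<dots> = max_mod f \<sigma>" by (simp add: M_def exp_minus)
  finally show ?thesis .
qed

lemma max_mod_pos: "0 < max_mod f \<sigma>"
  using max_mod_ge[of \<sigma>] b0 by (meson exp_gt_zero less_le_trans mult_pos_pos zero_less_norm_iff)

lemma strict_mono_max_mod: "strict_mono (max_mod f)"
proof (rule strict_monoI)
  fix x y :: real assume "x < y"
  then have "1 < exp ((y - x) * k 0)" using k_pos by simp
  then have "max_mod f x < exp ((y - x) * k 0) * max_mod f x"
    using max_mod_pos[of x] by simp
  also have "\<dots> \<le> max_mod f y" using \<open>x < y\<close> by (intro max_mod_growth) simp
  finally show "max_mod f x < max_mod f y" .
qed

text \<open>The bound is uniform in \<open>t\<close>, so it survives the supremum and makes the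
  maximum modulus Lipschitz on \<open>{..S}\<close>.\<close>

lemma norm_diff_le:
  assumes "\<sigma> \<le> \<sigma>'" "\<sigma>' \<le> S"
  shows "norm (f (Complex \<sigma>' t) - f (Complex \<sigma> t)) \<le> (\<sigma>' - \<sigma>) * (\<Sum>n. exp ((S + 1) * k n) * norm (b n))"
proof -
  let ?E = "\<lambda>\<sigma> n. exp (Complex \<sigma> t * complex_of_real (k n))"
  have "(\<lambda>n. (?E \<sigma>' n - ?E \<sigma> n) *\<^sub>C b n) sums (f (Complex \<sigma>' t) - f (Complex \<sigma> t))"
    using sums_diff[OF sums[of "Complex \<sigma>' t"] sums[of "Complex \<sigma> t"]]
    by (simp add: linear_diff[OF bounded_linear.linear[OF bounded_linear_scaleC_left]])
  then have "f (Complex \<sigma>' t) - f (Complex \<sigma> t) = (\<Sum>n. (?E \<sigma>' n - ?E \<sigma> n) *\<^sub>C b n)"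
    by (rule sums_unique)
  also have "norm \<dots> \<le> (\<Sum>n. (\<sigma>' - \<sigma>) * (exp ((S + 1) * k n) * norm (b n)))"
  proof (rule norm_suminf_le)
    fix n
    have E: "?E x n = exp (complex_of_real (x * k n)) * exp (\<i> * complex_of_real (t * k n))" for x
      by (simp add: Complex_eq algebra_simps flip: exp_add)
    have "?E \<sigma>' n - ?E \<sigma> n =
        complex_of_real (exp (\<sigma>' * k n) - exp (\<sigma> * k n)) * exp (\<i> * complex_of_real (t * k n))"
      unfolding E by (simp only: exp_of_real of_real_diff left_diff_distrib)
    then have "cmod (?E \<sigma>' n - ?E \<sigma> n) = \<bar>exp (\<sigma>' * k n) - exp (\<sigma> * k n)\<bar>"
      by (simp only: norm_mult norm_of_real norm_exp_i_times mult_1_right)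
    also have "\<dots> = exp (\<sigma>' * k n) - exp (\<sigma> * k n)"
      using assms less_imp_le[OF k_pos] by (simp add: mult_right_mono)
    also have "\<dots> = exp (\<sigma>' * k n) * (1 - exp (- ((\<sigma>' - \<sigma>) * k n)))"
      by (simp add: algebra_simps flip: exp_add)
    \<comment> \<open>The factor \<open>k n\<close> coming from \<open>1 - exp (- y) \<le> y\<close>
      is absorbed into \<open>exp (k n)\<close>, which raises the abscissa from \<open>S\<close> to
      \<open>S + 1\<close>, where the series still converges absolutely.\<close>
    also have "\<dots> \<le> exp (S * k n) * ((\<sigma>' - \<sigma>) * exp (k n))"
    proof (rule mult_mono)
      have "1 - exp (- ((\<sigma>' - \<sigma>) * k n)) \<le> (\<sigma>' - \<sigma>) * k n"
        using exp_ge_add_one_self[of "- ((\<sigma>' - \<sigma>) * k n)"] by linarith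
      also have "\<dots> \<le> (\<sigma>' - \<sigma>) * exp (k n)"
        using assms exp_ge_add_one_self[of "k n"] by (intro mult_left_mono) linarith+
      finally show "1 - exp (- ((\<sigma>' - \<sigma>) * k n)) \<le> (\<sigma>' - \<sigma>) * exp (k n)" .
    qed (use assms k_pos[of n] in \<open>auto simp: mult_right_mono\<close>)
    also have "\<dots> = (\<sigma>' - \<sigma>) * exp ((S + 1) * k n)"
      by (simp add: algebra_simps exp_add)
    finally show "norm ((?E \<sigma>' n - ?E \<sigma> n) *\<^sub>C b n) \<le> (\<sigma>' - \<sigma>) * (exp ((S + 1) * k n) * norm (b n))"
      by (simp add: norm_scaleC mult_right_mono flip: mult.assoc)
  qed (rule summable_mult[OF summable_norm])
  also have "\<dots> = (\<sigma>' - \<sigma>) * (\<Sum>n. exp ((S + 1) * k n) * norm (b n))"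
    by (rule suminf_mult[OF summable_norm])
  finally show ?thesis .
qed

lemma continuous_on_max_mod: "continuous_on {..S} (max_mod f)"
proof (rule lipschitz_on_continuous_on, rule lipschitz_on_leI)
  let ?D = "\<Sum>n. exp ((S + 1) * k n) * norm (b n)"
  fix x y assume xy: "x \<in> {..S}" "y \<in> {..S}" "x \<le> y"
  have "max_mod f y \<le> max_mod f x + (y - x) * ?D"
  proof (rule max_mod_le)
    fix t
    show "norm (f (Complex y t)) \<le> max_mod f x + (y - x) * ?D"
      using norm_diff_le[of x y S t] xy norm_le_max_mod[of "Complex x t"]
        norm_triangle_ineq[of "f (Complex y t) - f (Complex x t)" "f (Complex x t)"] by simp
  qed
  moreover have "max_mod f x \<le> max_mod f y"
    using strict_mono_max_mod xy by (simp add: strict_mono_less_eq)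
  ultimately show "dist (max_mod f x) (max_mod f y) \<le> ?D * dist x y"
    using xy by (simp add: dist_real_def mult.commute)
qed (auto intro!: suminf_nonneg summable_norm)

lemma range_max_mod: "range (max_mod f) = {0<..}"
proof (intro equalityI subsetI)
  fix y :: real assume "y \<in> {0<..}"
  then have y: "0 < y" by simp
  \<comment> \<open>\<open>hi\<close> makes the lower bound
    \<open>norm (b 0) * exp (hi * k 0)\<close> reach \<open>y\<close>; \<open>lo\<close> makes the
    growth estimate between \<open>lo\<close> and 0 push the maximum modulus below \<open>y\<close>.
    Clamping at 0 gives \<open>lo \<le> 0 \<le> hi\<close>, as needed for the growth estimate and
    the intermediate value theorem.\<close>
  define hi where "hi = max 0 (ln (y / norm (b 0)) / k 0)"
  define lo where "lo = min 0 (ln (y / max_mod f 0) / k 0)"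
  have "lo * k 0 \<le> ln (y / max_mod f 0)" 
    using k_pos[of 0] by (simp add: lo_def min_def field_simps)
  then have "exp (lo * k 0) \<le> y / max_mod f 0"
    using y max_mod_pos[of 0] by (metis divide_pos_pos exp_le_cancel_iff exp_ln)
  then have "max_mod f 0 \<le> exp (- lo * k 0) * y"
    using max_mod_pos[of 0] by (simp add: field_simps exp_minus)
  have "exp (- lo * k 0) * max_mod f lo \<le> max_mod f 0"
    using max_mod_growth[of lo 0] by (simp add: lo_def)
  also have "\<dots> \<le> exp (- lo * k 0) * y" by fact
  finally have lo: "max_mod f lo \<le> y" by simp
  have "ln (y / norm (b 0)) \<le> hi * k 0"
    using k_pos[of 0] by (simp add: hi_def max_def field_simps)
  then have "y / norm (b 0) \<le> exp (hi * k 0)"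
    using y b0 by (metis divide_pos_pos exp_le_cancel_iff exp_ln zero_less_norm_iff)
  then have "y \<le> norm (b 0) * exp (hi * k 0)"
    using b0 by (simp add: field_simps)
  then have hi: "y \<le> max_mod f hi" using max_mod_ge order_trans by blast
  have "lo \<le> hi" by (simp add: lo_def hi_def)
  then obtain x where "max_mod f x = y"
    using IVT'[OF lo hi _ continuous_on_subset[OF continuous_on_max_mod[of hi]]] by auto
  then show "y \<in> range (max_mod f)" by auto
qed (use max_mod_pos in auto)

end

section \<open>Absolute convergence and the first nonzero coefficient\<close>

lemma vvds_summable:
  assumes l_pos: "\<And>n. n \<ge> 1 \<Longrightarrow> 0 < l n"
    and l: "limsup (\<lambda>n. ereal (ln (real n) / l n)) < \<infinity>"
    and a: "limsup (\<lambda>n. elog (norm (a n :: 'a::real_normed_vector)) / ereal (l n)) = -\<infinity>"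
  shows "summable (\<lambda>n. exp (\<sigma> * l n) * norm (a n))"
proof -
  obtain C where C: "limsup (\<lambda>n. ereal (ln (real n) / l n)) < ereal C"
    using l ereal_dense2 less_PInf_Ex_of_nat by blast
  \<comment> \<open>With this constant the factor \<open>exp (\<sigma> * l n)\<close> is cancelled
    and \<open>exp (- 2 * (C * l n))\<close> is left, which is at most \<open>1 / n^2\<close>
    because eventually \<open>ln n < C * l n\<close>.\<close>
  have "limsup (\<lambda>n. elog (norm (a n)) / ereal (l n)) < ereal (- (\<sigma> + 2 * C))"
    by (simp add: a)
  from Limsup_lessD[OF this] Limsup_lessD[OF C] eventually_ge_at_top[of 1]
  have "\<forall>\<^sub>F n in sequentially. norm (exp (\<sigma> * l n) * norm (a n)) \<le> inverse (real n ^ 2)"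
  proof eventually_elim
    case (elim n)
    have ln: "0 < l n" using l_pos elim by simp
    have "norm (a n) \<le> exp (- (\<sigma> + 2 * C) * l n)"
    proof (cases "a n = 0")
      case False
      then have "ln (norm (a n)) / l n < - (\<sigma> + 2 * C)"
        using elim(1) ln by (simp add: elog_def)
      then have "ln (norm (a n)) \<le> - (\<sigma> + 2 * C) * l n"
        using ln by (simp add: field_simps)
      then show ?thesis using False by (metis exp_le_cancel_iff exp_ln zero_less_norm_iff)
    qed simp
    then have "exp (\<sigma> * l n) * norm (a n) \<le> exp (\<sigma> * l n) * exp (- (\<sigma> + 2 * C) * l n)"
      by simp
    also have "\<dots> = exp (- 2 * (C * l n))" by (simp add: algebra_simps flip: exp_add)
    also have "\<dots> \<le> exp (- 2 * ln (real n))"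
      using elim ln by (simp add: field_simps)
    also have "\<dots> = inverse (real n ^ 2)"
      using elim by (simp add: exp_minus exp_of_nat_mult[of 2, simplified])
    finally show ?case by simp
  qed
  then show ?thesis
    by (rule summable_comparison_test_ev) (use inverse_power_summable[of 2, where 'a = real] in simp)
qed

lemma vvds_dirichlet_series:
  assumes "vvds f"
  obtains b k where "dirichlet_series b k f"
proof -
  obtain s a l where s: "f s \<noteq> 0" and l_step: "\<forall>n\<ge>1. 0 < l n \<and> l n < l (Suc n)"
    and l: "limsup (\<lambda>n. ereal (ln (real n) / l n)) < \<infinity>"
    and a: "limsup (\<lambda>n. elog (norm (a n)) / ereal (l n)) = -\<infinity>"
    and f: "\<And>s. (\<lambda>n. exp (s * complex_of_real (l (Suc n))) *\<^sub>C a (Suc n)) sums f s"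
    using assms unfolding vvds_def by auto
  have zero: "c *\<^sub>C (0::'a) = 0" for c
    using linear_0[OF bounded_linear.linear[OF bounded_linear_scaleC_right]] .
  have "\<exists>n. a (Suc n) \<noteq> 0"
  proof (rule ccontr)
    assume "\<not> ?thesis"
    then have "(\<lambda>n. 0) sums f s" using f[of s] by (simp add: zero)
    from sums_unique2[OF this sums_zero] s show False by simp
  qed
  \<comment> \<open>The coefficients before \<open>N\<close> vanish, so shifting by \<open>N\<close>
    leaves the sum unchanged; the extra \<open>Suc\<close> reflects that the sequences in
    \<open>vvds\<close> start at index 1.\<close>
  define N where "N = (LEAST n. a (Suc n) \<noteq> 0)"
  have N: "a (Suc N) \<noteq> 0" unfolding N_def by (rule LeastI_ex) fact
  have before: "a (Suc n) = 0" if "n < N" for n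
    using not_less_Least[of n "\<lambda>n. a (Suc n) \<noteq> 0"] that by (auto simp: N_def)
  have "dirichlet_series (\<lambda>n. a (Suc (n + N))) (\<lambda>n. l (Suc (n + N))) f"
  proof
    show "strict_mono (\<lambda>n. l (Suc (n + N)))"
      using l_step by (simp add: strict_mono_Suc_iff)
    show "summable (\<lambda>n. exp (\<sigma> * l (Suc (n + N))) * norm (a (Suc (n + N))))" for \<sigma>
      using summable_ignore_initial_segment[OF vvds_summable[OF _ l a, of \<sigma>], of "Suc N"] l_step by simp
    show "(\<lambda>n. exp (s * complex_of_real (l (Suc (n + N)))) *\<^sub>C a (Suc (n + N))) sums f s" for s
      using f[of s] before
      by (subst sums_zero_iff_shift[where f = "\<lambda>n. exp (s * complex_of_real (l (Suc n))) *\<^sub>C a (Suc n)"])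
        (auto simp: zero)
  qed (use l_step N in auto)
  then show ?thesis by (rule that)
qed

lemma
  assumes "vvds f"
  shows vvds_strict_mono_max_mod: "strict_mono (max_mod f)"
    and vvds_range_max_mod: "range (max_mod f) = {0<..}"
proof -
  obtain b k where "dirichlet_series b k f" using vvds_dirichlet_series[OF assms] .
  then interpret dirichlet_series b k f .
  show "strict_mono (max_mod f)" by (rule strict_mono_max_mod)
  show "range (max_mod f) = {0<..}" by (rule range_max_mod)
qed

section \<open>Comparison of relative types\<close>

text \<open>Both maximum moduli have the positive reals as range, so \<open>inv\<close> is evaluated
  at a value that is attained.\<close>

lemma max_mod_max_mod_inv:
  assumes "vvds f" "vvds g"
  shows "max_mod g (max_mod_inv g (max_mod f \<sigma>)) = max_mod f \<sigma>"
proof -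
  have "max_mod f \<sigma> \<in> range (max_mod g)"
    using vvds_range_max_mod[OF assms(1)] vvds_range_max_mod[OF assms(2)] by auto
  then show ?thesis unfolding max_mod_inv_def by (rule f_inv_into_f)
qed

lemma max_mod_inv_max_mod:
  assumes "vvds f"
  shows "max_mod_inv f (max_mod f \<sigma>) = \<sigma>"
  using strict_mono_imp_inj_on[OF vvds_strict_mono_max_mod[OF assms]]
  by (simp add: max_mod_inv_def)

text \<open>Exchanging \<open>f\<close> and \<open>g\<close> gives the inverse map. Both maps are
  monotone, so both tend to infinity and the filter \<open>at_top\<close> is preserved. Limits
  superior and inferior can then be transported along the map.\<close>

lemma
  assumes "vvds f" "vvds g"
  shows inj_max_mod_inv_comp: "inj (\<lambda>\<sigma>. max_mod_inv g (max_mod f \<sigma>))"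
    and filtermap_max_mod_inv_comp: "filtermap (\<lambda>\<sigma>. max_mod_inv g (max_mod f \<sigma>)) at_top = at_top"
proof -
  let ?R = "\<lambda>f g \<sigma>. max_mod_inv g (max_mod f \<sigma>)"
  \<comment> \<open>Stated for fresh types so that it serves both for \<open>f\<close>,
    \<open>g\<close> and for the exchanged pair.\<close>
  have mono: "mono (?R f g)" and inverse: "?R f g (?R g f x) = x"
    if "vvds f" "vvds g" for f :: "complex \<Rightarrow> 'x::complex_banach" and g :: "complex \<Rightarrow> 'y::complex_banach" and x
  proof -
    show "?R f g (?R g f x) = x"
      using that by (simp add: max_mod_max_mod_inv max_mod_inv_max_mod)
    show "mono (?R f g)"
    proof (rule monoI)
      fix x y :: real assume "x \<le> y"
      then have "max_mod g (?R f g x) \<le> max_mod g (?R f g y)"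
        using that by (simp add: max_mod_max_mod_inv strict_mono_less_eq vvds_strict_mono_max_mod)
      then show "?R f g x \<le> ?R f g y"
        using that by (simp add: strict_mono_less_eq vvds_strict_mono_max_mod)
    qed
  qed
  have lim: "filterlim (?R f g) at_top at_top"
    if "vvds f" "vvds g" for f :: "complex \<Rightarrow> 'x::complex_banach" and g :: "complex \<Rightarrow> 'y::complex_banach"
    unfolding filterlim_at_top
  proof
    fix z
    show "\<forall>\<^sub>F x in at_top. z \<le> ?R f g x"
      using eventually_ge_at_top[of "?R g f z"]
      by eventually_elim (use monoD[OF mono[OF that]] inverse[OF that, of z] in metis)
  qed
  show "inj (?R f g)"
    using inverse[OF assms(2,1)] by (rule inj_on_inverseI)
  show "filtermap (?R f g) at_top = at_top"
    by (rule filtermap_fun_inverse[of "?R g f"])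
      (use lim[OF assms] lim[OF assms(2,1)] inverse[OF assms] in auto)
qed

text \<open>Negative indices have to be covered, because types use the index \<open>p - 1\<close>,
  which is \<open>-1\<close> for \<open>p = 0\<close>.\<close>

lemma filterlim_iter_log: "filterlim (iter_log k) at_top at_top"
proof -
  have funpow: "filterlim (h ^^ n) at_top at_top"
    if "filterlim h at_top at_top" for h :: "real \<Rightarrow> real" and n
    by (induction n) (auto simp: o_def filterlim_ident intro: filterlim_compose[OF that])
  show ?thesis
    unfolding iter_log_def by (cases "k \<ge> 0") (auto intro!: funpow ln_at_top exp_at_top)
qed

section \<open>Ratios under the change of variable\<close>

text \<open>\<open>R\<close> is the substitution of \<open>r\<close> for \<open>\<sigma>\<close>.
  The functions \<open>u\<close>, \<open>v\<close>, \<open>w\<close> stand for the iterated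
  logarithms belonging to \<open>m\<close>, \<open>p\<close>, \<open>q\<close>, with these indices
  for orders and with indices lowered by one for types.\<close>

context
  fixes R u v w :: "real \<Rightarrow> real"
  assumes inj_R: "inj R" and R: "filtermap R at_top = at_top"
    and u: "filterlim u at_top at_top" and v: "filterlim v at_top at_top" and w: "filterlim w at_top at_top"
begin

private lemma lim_R: "filterlim R at_top at_top"
  by (simp add: filterlim_def R)

private lemma pos:
  "\<forall>\<^sub>F r in at_top. 0 < u r" "\<forall>\<^sub>F r in at_top. 0 < v r" "\<forall>\<^sub>F \<sigma> in at_top. 0 < w \<sigma>"
  "\<forall>\<^sub>F \<sigma> in at_top. 0 < u (R \<sigma>)" "\<forall>\<^sub>F \<sigma> in at_top. 0 < v (R \<sigma>)"
  using u v w filterlim_compose[OF u lim_R] filterlim_compose[OF v lim_R]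
  by (simp_all add: filterlim_at_top_dense)

private lemma Limsup_R: "Limsup at_top (\<lambda>\<sigma>. \<psi> (R \<sigma>)) = Limsup at_top \<psi>" for \<psi> :: "real \<Rightarrow> ereal"
  using Limsup_filtermap_eq[OF inj_R, of at_top \<psi>] R by simp

private lemma Liminf_R: "Liminf at_top (\<lambda>\<sigma>. \<psi> (R \<sigma>)) = Liminf at_top \<psi>" for \<psi> :: "real \<Rightarrow> ereal"
  using Liminf_filtermap_eq[OF inj_R, of at_top \<psi>] R by simp

text \<open>The ratio is the product of \<open>u (R \<sigma>) / v (R \<sigma>)\<close> and
  \<open>v (R \<sigma>) / w \<sigma>\<close>. The first factor has the limit \<open>A\<close>, and
  as \<open>A\<close> is positive and finite no indeterminate product arises, so the upper and lower
  product estimates meet.\<close>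

lemma
  assumes A: "0 < A"
    and lim: "Liminf at_top (\<lambda>r. ereal (u r / v r)) = ereal A" "Limsup at_top (\<lambda>r. ereal (u r / v r)) = ereal A"
  shows Limsup_ratio_comp:
      "Limsup at_top (\<lambda>\<sigma>. ereal (u (R \<sigma>) / w \<sigma>)) = ereal A * Limsup at_top (\<lambda>\<sigma>. ereal (v (R \<sigma>) / w \<sigma>))"
    and Liminf_ratio_comp:
      "Liminf at_top (\<lambda>\<sigma>. ereal (u (R \<sigma>) / w \<sigma>)) = ereal A * Liminf at_top (\<lambda>\<sigma>. ereal (v (R \<sigma>) / w \<sigma>))"
proof -
  let ?X = "\<lambda>\<sigma>. u (R \<sigma>) / v (R \<sigma>)" and ?Y = "\<lambda>\<sigma>. v (R \<sigma>) / w \<sigma>"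
  have X: "\<forall>\<^sub>F \<sigma> in at_top. 0 \<le> ?X \<sigma>" using pos(4,5) by eventually_elim simp
  have Y: "\<forall>\<^sub>F \<sigma> in at_top. 0 \<le> ?Y \<sigma>" using pos(3,5) by eventually_elim simp
  have XY: "\<forall>\<^sub>F \<sigma> in at_top. ereal (u (R \<sigma>) / w \<sigma>) = ereal (?X \<sigma> * ?Y \<sigma>)"
    using pos(5) by eventually_elim simp
  have limX: "Liminf at_top (\<lambda>\<sigma>. ereal (?X \<sigma>)) = ereal A" "Limsup at_top (\<lambda>\<sigma>. ereal (?X \<sigma>)) = ereal A"
    using lim Liminf_R[of "\<lambda>r. ereal (u r / v r)"] Limsup_R[of "\<lambda>r. ereal (u r / v r)"] by auto
  note F = trivial_limit_at_top_linorder
  show "Limsup at_top (\<lambda>\<sigma>. ereal (u (R \<sigma>) / w \<sigma>)) = ereal A * Limsup at_top (\<lambda>\<sigma>. ereal (?Y \<sigma>))"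
    unfolding Limsup_eq[OF XY]
    using Limsup_mult_le[OF F X Y] Limsup_mult_ge[OF F Y X] A
    by (intro antisym) (auto simp: limX mult.commute)
  show "Liminf at_top (\<lambda>\<sigma>. ereal (u (R \<sigma>) / w \<sigma>)) = ereal A * Liminf at_top (\<lambda>\<sigma>. ereal (?Y \<sigma>))"
    unfolding Liminf_eq[OF XY]
    using Liminf_mult_ge[OF F X Y] Liminf_mult_le[OF F Y X] A
    by (intro antisym) (auto simp: limX mult.commute)
qed

text \<open>Dividing \<open>\<phi> \<sigma>\<close> by \<open>\<gamma> (R \<sigma>)\<close> cancels
  \<open>u\<close> and leaves the \<open>A\<close>-th power of \<open>\<theta> \<sigma>\<close>. The
  chain then consists of the four product estimates for \<open>\<phi>\<close> and the reciprocal of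
  \<open>\<gamma>\<close>, with an \<open>A\<close>-th root taken.\<close>

lemma type_comparison:
  fixes A e :: real
  assumes A: "0 < A"
  defines "\<phi> \<equiv> \<lambda>\<sigma>. u (R \<sigma>) / w \<sigma> powr (A * e)"
    and "\<gamma> \<equiv> \<lambda>r. u r / v r powr A"
    and "\<theta> \<equiv> \<lambda>\<sigma>. v (R \<sigma>) / w \<sigma> powr e"
  defines "F \<equiv> Limsup at_top (\<lambda>\<sigma>. ereal (\<phi> \<sigma>))" and "F' \<equiv> Liminf at_top (\<lambda>\<sigma>. ereal (\<phi> \<sigma>))"
    and "G \<equiv> Limsup at_top (\<lambda>r. ereal (\<gamma> r))" and "G' \<equiv> Liminf at_top (\<lambda>r. ereal (\<gamma> r))"
    and "T \<equiv> Limsup at_top (\<lambda>\<sigma>. ereal (\<theta> \<sigma>))" and "T' \<equiv> Liminf at_top (\<lambda>\<sigma>. ereal (\<theta> \<sigma>))"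
    and "rt \<equiv> eroot (ereal A)"
  shows "(quot_ok F' G \<longrightarrow> rt (F' / G) \<le> T') \<and>
    (quot_ok F' G' \<and> quot_ok F G \<longrightarrow>
      T' \<le> min (rt (F' / G')) (rt (F / G)) \<and>
      min (rt (F' / G')) (rt (F / G)) \<le> max (rt (F' / G')) (rt (F / G)) \<and>
      max (rt (F' / G')) (rt (F / G)) \<le> T) \<and>
    (quot_ok F G' \<longrightarrow> T \<le> rt (F / G'))"
proof -
  let ?inv = "\<lambda>\<sigma>. inverse (\<gamma> (R \<sigma>))"
  define S where "S \<sigma> = \<phi> \<sigma> * ?inv \<sigma>" for \<sigma>
  note at_top = trivial_limit_at_top_linorder
  have \<phi>: "\<forall>\<^sub>F \<sigma> in at_top. 0 \<le> \<phi> \<sigma>"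
    using pos(4) by eventually_elim (simp add: \<phi>_def)
  have \<gamma>: "\<forall>\<^sub>F \<sigma> in at_top. 0 < \<gamma> (R \<sigma>)"
    using pos(4,5) by eventually_elim (simp add: \<gamma>_def)
  then have inv: "\<forall>\<^sub>F \<sigma> in at_top. 0 \<le> ?inv \<sigma>" by eventually_elim simp
  have S: "\<forall>\<^sub>F \<sigma> in at_top. 0 \<le> S \<sigma>"
    using \<phi> inv by eventually_elim (simp add: S_def)
  have \<theta>: "\<forall>\<^sub>F \<sigma> in at_top. ereal (\<theta> \<sigma>) = ereal (S \<sigma> powr (1 / A))"
    using pos(3-5)
  proof eventually_elim
    case (elim \<sigma>)
    have "\<theta> \<sigma> powr A = v (R \<sigma>) powr A / w \<sigma> powr (A * e)"
      using elim by (simp add: \<theta>_def powr_divide powr_powr mult.commute)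
    also have "\<dots> = S \<sigma>" using elim by (simp add: S_def \<phi>_def \<gamma>_def field_simps)
    finally have "S \<sigma> powr (1 / A) = (\<theta> \<sigma> powr A) powr (1 / A)" by simp
    also have "\<dots> = \<theta> \<sigma>" using A elim by (simp add: powr_powr \<theta>_def)
    finally show ?case by simp
  qed
  have T: "T = rt (Limsup at_top (\<lambda>\<sigma>. ereal (S \<sigma>)))" "T' = rt (Liminf at_top (\<lambda>\<sigma>. ereal (S \<sigma>)))"
    unfolding T_def T'_def rt_def Limsup_eq[OF \<theta>] Liminf_eq[OF \<theta>]
    by (rule Limsup_powr[OF at_top A S], rule Liminf_powr[OF at_top A S])
  have inv_lim: "Limsup at_top (\<lambda>\<sigma>. ereal (?inv \<sigma>)) = inverse G'" "Liminf at_top (\<lambda>\<sigma>. ereal (?inv \<sigma>)) = inverse G"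
    using Limsup_inverse_pos[OF at_top \<gamma>] Liminf_inverse_pos[OF at_top \<gamma>]
      Liminf_R[of "\<lambda>r. ereal (\<gamma> r)"] Limsup_R[of "\<lambda>r. ereal (\<gamma> r)"]
    by (simp_all add: G_def G'_def)
  have "\<forall>\<^sub>F r in at_top. 0 \<le> \<gamma> r"
    using pos(1,2) by eventually_elim (simp add: \<gamma>_def)
  then have nonneg: "0 \<le> F" "0 \<le> F'" "0 \<le> inverse G" "0 \<le> inverse G'" "0 \<le> G" "0 \<le> G'"
    using Limsup_nonneg[OF at_top \<phi>] Liminf_nonneg[OF \<phi>] Limsup_nonneg[OF at_top inv] Liminf_nonneg[OF inv]
      Limsup_nonneg[OF at_top, of \<gamma>] Liminf_nonneg[of \<gamma>]
    by (simp_all add: F_def F'_def G_def G'_def inv_lim)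
  have SI: "0 \<le> Liminf at_top (\<lambda>\<sigma>. ereal (S \<sigma>))" by (rule Liminf_nonneg[OF S])
  have SS: "0 \<le> Limsup at_top (\<lambda>\<sigma>. ereal (S \<sigma>))" by (rule Limsup_nonneg[OF at_top S])
  have rt_mono: "rt x \<le> rt y" if "0 \<le> x" "x \<le> y" for x y
    unfolding rt_def using that A by (intro eroot_mono) auto
  \<comment> \<open>Turns \<open>quot_ok\<close> into the exclusions demanded by the upper product
    estimates, a quotient being a product with the inverse.\<close>
  have indet: "\<not> (x = 0 \<and> inverse y = \<infinity>)" "\<not> (x = \<infinity> \<and> inverse y = 0)" if "quot_ok x y" "0 \<le> y" for x y
    using that by (cases y; force simp: quot_ok_def split: if_splits)+
  have S_comm: "S \<sigma> = ?inv \<sigma> * \<phi> \<sigma>" for \<sigma> by (simp add: S_def mult.commute)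
  have 1: "rt (F' / G) \<le> T'"
    unfolding T using Liminf_mult_ge[OF at_top \<phi> inv] nonneg
    by (intro rt_mono) (simp_all add: S_def F'_def inv_lim divide_ereal_def)
  have 2: "T' \<le> rt (F' / G')" if "quot_ok F' G'"
    unfolding T using Liminf_mult_le[OF at_top \<phi> inv] indet[OF that nonneg(6)]
    by (intro rt_mono SI) (simp add: S_def F'_def inv_lim divide_ereal_def)
  \<comment> \<open>With the factors exchanged, the limit superior falls on \<open>\<phi>\<close>
    and the limit inferior on the reciprocal, which gives \<open>F / G\<close> instead of
    \<open>F' / G'\<close>.\<close>
  have 3: "T' \<le> rt (F / G)" if "quot_ok F G"
    unfolding T using Liminf_mult_le[OF at_top inv \<phi>] indet[OF that nonneg(5)]
    by (intro rt_mono SI) (auto simp: S_comm F_def inv_lim divide_ereal_def mult.commute)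
  have 4: "rt (F / G) \<le> T"
    unfolding T using Limsup_mult_ge[OF at_top \<phi> inv] nonneg
    by (intro rt_mono) (simp_all add: S_def F_def inv_lim divide_ereal_def)
  have 5: "rt (F' / G') \<le> T"
    unfolding T using Limsup_mult_ge[OF at_top inv \<phi>] nonneg
    by (intro rt_mono) (simp_all add: S_comm F'_def inv_lim divide_ereal_def mult.commute)
  have 6: "T \<le> rt (F / G')" if "quot_ok F G'"
    unfolding T using Limsup_mult_le[OF at_top \<phi> inv] indet[OF that nonneg(6)]
    by (intro rt_mono SS) (simp add: S_def F_def inv_lim divide_ereal_def)
  show ?thesis using 1 2 3 4 5 6 by (simp add: min.coboundedI1)
qed

end

theorem theorem6:
  fixes p q m :: int
    and f :: "complex \<Rightarrow> 'a::complex_banach"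
    and g :: "complex \<Rightarrow> 'b::complex_banach"
    and h :: "complex \<Rightarrow> 'c::complex_banach"
  assumes "p \<ge> 0" and "q \<ge> 0" and "m \<ge> 0"
    and "vvds f" and "vvds g" and "vvds h"
    and "has_rel_index_pair h m q f"
    and "has_rel_index_pair h m p g"
    and "rel_lower_order h m p g = rel_order h m p g"
  shows
    "(pos_finite (rel_order h m q f) \<and> pos_finite (rel_order h m p g)
        \<and> pos_finite (rel_order g p q f) \<longrightarrow>
      (let root = eroot (rel_order h m p g);
           F = rel_type h m q f; F' = rel_lower_type h m q f;
           G = rel_type h m p g; G' = rel_lower_type h m p g
       in (quot_ok F' G \<longrightarrow> root (F' / G) \<le> rel_lower_type g p q f)
        \<and> (quot_ok F' G' \<and> quot_ok F G \<longrightarrow>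
             rel_lower_type g p q f \<le> min (root (F' / G')) (root (F / G))
           \<and> min (root (F' / G')) (root (F / G)) \<le> max (root (F' / G')) (root (F / G))
           \<and> max (root (F' / G')) (root (F / G)) \<le> rel_type g p q f)
        \<and> (quot_ok F G' \<longrightarrow> rel_type g p q f \<le> root (F / G'))))
   \<and> (pos_finite (rel_lower_order h m q f) \<and> pos_finite (rel_lower_order h m p g)
        \<and> pos_finite (rel_lower_order g p q f) \<longrightarrow>
      (let root = eroot (rel_lower_order h m p g);
           F = rel_weak_indicator h m q f; F' = rel_weak_type h m q f;
           G = rel_weak_indicator h m p g; G' = rel_weak_type h m p g
       in (quot_ok F' G \<longrightarrow> root (F' / G) \<le> rel_weak_type g p q f)
        \<and> (quot_ok F' G' \<and> quot_ok F G \<longrightarrow>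
             rel_weak_type g p q f \<le> min (root (F' / G')) (root (F / G))
           \<and> min (root (F' / G')) (root (F / G)) \<le> max (root (F' / G')) (root (F / G))
           \<and> max (root (F' / G')) (root (F / G)) \<le> rel_weak_indicator g p q f)
        \<and> (quot_ok F G' \<longrightarrow> rel_weak_indicator g p q f \<le> root (F / G'))))"
proof -
  define R where "R \<sigma> = max_mod_inv g (max_mod f \<sigma>)" for \<sigma>
  define H where "H r = max_mod_inv h (max_mod g r)" for r
  have R: "inj R" "filtermap R at_top = at_top"
    unfolding R_def using assms inj_max_mod_inv_comp filtermap_max_mod_inv_comp by auto
  have "filterlim H at_top at_top"
    unfolding H_def filterlim_def using assms filtermap_max_mod_inv_comp by force
  then have lim: "filterlim (\<lambda>r. iter_log k (H r)) at_top at_top" for k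
    by (rule filterlim_compose[OF filterlim_iter_log])
  have HR: "max_mod_inv h (max_mod f \<sigma>) = H (R \<sigma>)" for \<sigma>
    unfolding H_def R_def using assms by (simp add: max_mod_max_mod_inv)
  \<comment> \<open>The type comparison uses all indices lowered by one, whereas the comparison of
    orders in \<open>ratio\<close> uses \<open>m\<close>, \<open>p\<close>, \<open>q\<close>
    themselves.\<close>
  note comparison = type_comparison[OF R lim[of "m - 1"] filterlim_iter_log[of "p - 1"] filterlim_iter_log[of "q - 1"]]
  note ratio = Limsup_ratio_comp[OF R lim[of m] filterlim_iter_log[of p] filterlim_iter_log[of q]]
    Liminf_ratio_comp[OF R lim[of m] filterlim_iter_log[of p] filterlim_iter_log[of q]]
  have gh: "rel_order h m p g = Limsup at_top (\<lambda>r. ereal (iter_log m (H r) / iter_log p r))"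
    "rel_lower_order h m p g = Liminf at_top (\<lambda>r. ereal (iter_log m (H r) / iter_log p r))"
    by (simp_all add: rel_order_def rel_lower_order_def H_def)
  show ?thesis
  proof (cases "pos_finite (rel_order h m p g)")
    case True
    then obtain A where A: "rel_order h m p g = ereal A" "0 < A"
      by (cases "rel_order h m p g") (auto simp: pos_finite_def)
    \<comment> \<open>The regularity assumption on \<open>g\<close> enters here: order and lower
      order are the same limit \<open>A\<close>, so both halves of the claim have the root of
      exponent \<open>1 / A\<close>.\<close>
    then have A': "rel_lower_order h m p g = ereal A" using assms by simp
    note limits = A'[unfolded gh] A(1)[unfolded gh]
    \<comment> \<open>This gives the exponents for \<open>f\<close> relative to \<open>h\<close> the
      form \<open>A * e\<close> required by \<open>type_comparison\<close>, where \<open>e\<close>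
      is the order of \<open>f\<close> relative to \<open>g\<close> in the first half and the lower
      order in the second.\<close>
    have orders: "real_of_ereal (rel_order h m q f) = A * real_of_ereal (rel_order g p q f)"
      "real_of_ereal (rel_lower_order h m q f) = A * real_of_ereal (rel_lower_order g p q f)"
      using ratio[OF A(2) limits]
      by (simp_all add: rel_order_def rel_lower_order_def HR R_def[symmetric])
    have unfold: "type_ratio h m q f (rel_order h m q f) = (\<lambda>\<sigma>. ereal (iter_log (m - 1) (H (R \<sigma>)) /
          iter_log (q - 1) \<sigma> powr (A * real_of_ereal (rel_order g p q f))))"
      "type_ratio h m q f (rel_lower_order h m q f) = (\<lambda>\<sigma>. ereal (iter_log (m - 1) (H (R \<sigma>)) /
          iter_log (q - 1) \<sigma> powr (A * real_of_ereal (rel_lower_order g p q f))))"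
      "type_ratio h m p g (ereal A) = (\<lambda>r. ereal (iter_log (m - 1) (H r) / iter_log (p - 1) r powr A))"
      "type_ratio g p q f e = (\<lambda>\<sigma>. ereal (iter_log (p - 1) (R \<sigma>) / iter_log (q - 1) \<sigma> powr real_of_ereal e))" for e
      by (simp_all add: fun_eq_iff type_ratio_def orders HR H_def[symmetric] R_def[symmetric])
    show ?thesis
      unfolding Let_def rel_type_def rel_lower_type_def rel_weak_type_def rel_weak_indicator_def A A' unfold
      by (intro conjI[OF impI impI] comparison[OF A(2)])
  next
    \<comment> \<open>Both halves hold vacuously: the order and the lower order of \<open>g\<close>
      relative to \<open>h\<close> agree, and each half presupposes that one of them is positive and
      finite.\<close>
    case False
    then show ?thesis using assms by simp
  qed
qed

end
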